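(* For every integer $t\geq 14$ and every real $\epsilon>0$ there is $\gamma=\gamma(t,\epsilon)\in(0,1]$ (depending only on $t$ and $\epsilon$) such that the following holds for every integer $n\geq t$, every $\eta\in(0,1]$ and every $p$ with $0<p\leq\frac{1}{t+1}-\epsilon$. If $\mathcal{A}$ and $\mathcal{B}$ are shifted, inclusion maximal cross $t$-intersecting families in $2^{[n]}$, then at least one of the following holds: (i) $\sqrt{\mu_p(\mathcal{A})\mu_p(\mathcal{B})}<(1-\gamma\eta)p^{t}$; (ii) $\mu_p(\mathcal{A}\bigtriangleup\mathcal{F}_0^t(n))+\mu_p(\mathcal{B}\bigtriangleup\mathcal{F}_0^t(n))<\eta p^t$.
   Context: For $F\subset[n]$, $\mu_p(F)=p^{|F|}(1-p)^{n-|F|}$ and $\mu_p(\mathcal{F})=\sum_{F\in\mathcal{F}}\mu_p(F)$. Families are cross $t$-intersecting if $|A\cap B|\ge t$ for all $A\in\mathcal{A},B\in\mathcal{B}$. A family $\mathcal{A}\subset 2^{[n]}$ is shifted if whenever $1\le i<j\le n$, $A\in\mathcal{A}$ and $A\cap\{i,j\}=\{j\}$, then $(A\setminus\{j\})\cup\{i\}\in\mathcal{A}$. A family $\mathcal{G}$ is inclusion maximal if $G\in\mathcal{G}$ and $G\subset G'\subset[n]$ imply $G'\in\mathcal{G}$. $\mathcal{F}_0^t(n)=\{F\subset[n]:[t]\subset F\}$. $\bigtriangleup$ denotes symmetric difference. *)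

theory Defs
  imports Complex_Main
begin

text \<open>
  The ground set \<open>[n]\<close> is \<open>{1..n}\<close> in \<^typ>\<open>nat\<close>; a family in \<open>2^[n]\<close> is a set
  \<open>\<F> \<subseteq> Pow {1..n}\<close>. The containment \<open>\<subset>\<close> of the source is non-strict.
\<close>

definition mu_set :: "nat \<Rightarrow> real \<Rightarrow> nat set \<Rightarrow> real" where
  "mu_set n p F = p ^ card F * (1 - p) ^ (n - card F)"

definition mu :: "nat \<Rightarrow> real \<Rightarrow> nat set set \<Rightarrow> real" where
  "mu n p \<F> = (\<Sum>F\<in>\<F>. mu_set n p F)"

definition cross_intersecting :: "nat \<Rightarrow> nat set set \<Rightarrow> nat set set \<Rightarrow> bool" where
  "cross_intersecting t \<A> \<B> \<longleftrightarrow> (\<forall>A\<in>\<A>. \<forall>B\<in>\<B>. t \<le> card (A \<inter> B))"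

definition shifted :: "nat \<Rightarrow> nat set set \<Rightarrow> bool" where
  "shifted n \<A> \<longleftrightarrow>
    (\<forall>i j A. 1 \<le> i \<and> i < j \<and> j \<le> n \<and> A \<in> \<A> \<and> A \<inter> {i, j} = {j}
       \<longrightarrow> (A - {j}) \<union> {i} \<in> \<A>)"

text \<open>
  Inclusion maximality is a property of a single family (being an up-set in \<open>2^[n]\<close>),
  not maximality of a pair among cross \<open>t\<close>-intersecting pairs.
\<close>

definition inclusion_maximal :: "nat \<Rightarrow> nat set set \<Rightarrow> bool" where
  "inclusion_maximal n \<G> \<longleftrightarrow>
    (\<forall>G G'. G \<in> \<G> \<and> G \<subseteq> G' \<and> G' \<subseteq> {1..n} \<longrightarrow> G' \<in> \<G>)"

definition F0 :: "nat \<Rightarrow> nat \<Rightarrow> nat set set" where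
  "F0 t n = {F. F \<subseteq> {1..n} \<and> {1..t} \<subseteq> F}"

end

theory Submission
  imports Defs "HOL-Analysis.Complex_Transcendental"
begin

text \<open>
  Read a set \<open>F \<subseteq> [n]\<close> as a walk with height \<open>h\<^sub>F k = 2|F \<inter> [k]| - k\<close>. Shiftedness turns cross
  \<open>t\<close>-intersection into: for all \<open>F \<in> \<A>\<close>, \<open>G \<in> \<B>\<close> there is \<open>k\<close> with \<open>h\<^sub>F k + h\<^sub>G k \<ge> 2t\<close>.
  Let \<open>u\<close>, \<open>v\<close> be the largest levels hit by all walks of \<open>\<A>\<close>, \<open>\<B>\<close>; then \<open>u + v \<ge> 2t\<close>. With
  \<open>\<alpha> = p/(1-p)\<close>, level \<open>u\<close> is hit with probability at most \<open>\<alpha>^u\<close>, and hit twice with probability at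
  most \<open>2p\<alpha>^u\<close>. Hence the product of the measures is well below \<open>p^(2t)\<close> unless \<open>u + v = 2t\<close> and both
  families contain walks hitting their level only once; all these hits then happen at one common
  time \<open>T\<close>. If \<open>T \<ge> u + 4\<close> (with \<open>u \<le> v\<close>), first passage at time \<open>T\<close> is too unlikely. In the three
  remaining cases \<open>\<A>\<close> is compared with \<open>{F. h\<^sub>F T \<ge> u}\<close>: a walk of \<open>\<A>\<close> outside this family that
  stays below \<open>u + j\<close> excludes from \<open>\<B>\<close> all walks that reach \<open>v\<close> at time \<open>T\<close>, step down \<open>j + 1\<close>
  times and stay below \<open>v - j\<close>, so that what \<open>\<A>\<close> gains is less than what \<open>\<B>\<close> loses.
\<close>

section \<open>Lattice walks\<close>

text \<open>Because of \<open>take\<close>, the height is constant after the end of the list, so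
  \<open>ht_le\<close> and \<open>ht_ge\<close> hold at all times; parity is the property that fails
  there.\<close>

definition ht :: "bool list \<Rightarrow> nat \<Rightarrow> int" where
  "ht w k = (\<Sum>x\<leftarrow>take k w. if x then 1 else -1)"

lemma ht_0 [simp]: "ht w 0 = 0"
  by (simp add: ht_def)

lemma ht_Cons [simp]: "ht (x # w) (Suc k) = (if x then 1 else -1) + ht w k"
  by (simp add: ht_def)

lemma ht_Nil [simp]: "ht [] k = 0"
  by (simp add: ht_def)

lemma ht_le_add: "ht w (k + d) \<le> ht w k + int d"
proof (induction k arbitrary: w)
  case 0
  show ?case
  proof (induction d arbitrary: w)
    case (Suc d)
    show ?case
    proof (cases w)
      case (Cons x xs)
      then show ?thesis using Suc[of xs] by simp
    qed simp
  qed simp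
next
  case (Suc k)
  show ?case
  proof (cases w)
    case (Cons x xs)
    then show ?thesis using Suc[of xs] by simp
  qed simp
qed

lemma ht_le: "k \<le> l \<Longrightarrow> ht w l \<le> ht w k + int (l - k)"
  using ht_le_add[of w k "l - k"] by simp

lemma ht_ge_diff: "ht w k - int d \<le> ht w (k + d)"
proof (induction k arbitrary: w)
  case 0
  show ?case
  proof (induction d arbitrary: w)
    case (Suc d)
    show ?case
    proof (cases w)
      case (Cons x xs)
      then show ?thesis using Suc[of xs] by simp
    qed simp
  qed simp
next
  case (Suc k)
  show ?case
  proof (cases w)
    case (Cons x xs)
    then show ?thesis using Suc[of xs] by simp
  qed simp
qed

lemma ht_ge: "k \<le> l \<Longrightarrow> ht w k - int (l - k) \<le> ht w l"
  using ht_ge_diff[of w k "l - k"] by simp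

lemma ht_le_self: "ht w k \<le> int k"
  using ht_le[of 0 k w] by simp

lemma ht_parity: "k \<le> length w \<Longrightarrow> even (ht w k + int k)"
proof (induction w arbitrary: k)
  case (Cons x w)
  then show ?case by (cases k) auto
qed simp

section \<open>Reaching a level: at all, twice, and for the first time\<close>

definition hits :: "nat \<Rightarrow> bool list \<Rightarrow> bool" where
  "hits u w \<longleftrightarrow> (\<exists>k\<le>length w. int u \<le> ht w k)"

text \<open>Counts times at or above the level, not visits to it. A walk that exceeds the level thus
  always hits twice, as \<open>not_hits_twice_le\<close> exploits.\<close>

definition hits_twice :: "nat \<Rightarrow> bool list \<Rightarrow> bool" where
  "hits_twice u w \<longleftrightarrow> (\<exists>k l. k < l \<and> l \<le> length w \<and> int u \<le> ht w k \<and> int u \<le> ht w l)"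

definition first_hits_at :: "nat \<Rightarrow> nat \<Rightarrow> bool list \<Rightarrow> bool" where
  "first_hits_at u T w \<longleftrightarrow> T \<le> length w \<and> ht w T = int u \<and> (\<forall>k<T. ht w k < int u)"

lemma ex_le_Suc_iff: "(\<exists>k\<le>Suc n. P k) \<longleftrightarrow> P 0 \<or> (\<exists>k\<le>n. P (Suc k))"
  by (metis Suc_le_mono not0_implies_Suc zero_le)

text \<open>First-step analysis: after an up-step the rest must climb \<open>u\<close>, after a
  down-step \<open>u + 2\<close>. The level is a successor so that time 0 is not yet a hit. The
  other Cons rules follow this pattern, which matches the recursions of \<open>pr\<close> and
  \<open>first_passage\<close>.\<close>

lemma hits_Cons: "hits (Suc u) (x # w) \<longleftrightarrow> (if x then hits u w else hits (u + 2) w)"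
  unfolding hits_def by (auto simp: ex_le_Suc_iff)

lemma hits_twice_Cons:
  "hits_twice (Suc u) (x # w) \<longleftrightarrow> (if x then hits_twice u w else hits_twice (u + 2) w)"
proof -
  have "hits_twice (Suc u) (x # w) \<longleftrightarrow>
      (\<exists>k l. k < l \<and> l \<le> length w \<and> int (Suc u) \<le> ht (x # w) (Suc k) \<and> int (Suc u) \<le> ht (x # w) (Suc l))"
    (is "?L \<longleftrightarrow> ?R")
  proof
    assume ?L
    then obtain k l where kl: "k < l" "l \<le> length (x # w)" "int (Suc u) \<le> ht (x # w) k"
      "int (Suc u) \<le> ht (x # w) l" unfolding hits_twice_def by blast
    from kl(3) have "k \<noteq> 0" by (auto intro: ccontr)
    then obtain k' l' where "k = Suc k'" "l = Suc l'" using kl(1) by (metis not0_implies_Suc not_less0)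
    then show ?R using kl by (intro exI[of _ k'] exI[of _ l']) auto
  next
    assume ?R
    then show ?L unfolding hits_twice_def by (metis Suc_le_mono Suc_less_eq length_Cons)
  qed
  moreover have "int (Suc u) \<le> ht (x # w) (Suc k) \<longleftrightarrow> int (if x then u else u + 2) \<le> ht w k" for k
    by auto
  ultimately show ?thesis unfolding hits_twice_def by presburger
qed

lemma hits_twice_0_Cons:
  assumes "hits_twice 0 (x # w)" "\<not> x"
  shows "hits 1 w"
proof -
  obtain k l where kl: "k < l" "l \<le> length (x # w)" "0 \<le> ht (x # w) l"
    using assms(1) unfolding hits_twice_def by auto
  then obtain l' where "l = Suc l'" by (metis not0_implies_Suc not_less0)
  then show ?thesis using kl assms(2) unfolding hits_def by auto
qed

lemma hits_0 [simp]: "hits 0 w"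
  unfolding hits_def by auto

lemma first_hits_at_simps [simp]:
  "first_hits_at 0 0 w"
  "\<not> first_hits_at 0 (Suc T) w"
  "\<not> first_hits_at (Suc u) 0 w"
  unfolding first_hits_at_def by auto

lemma all_less_Suc_iff: "(\<forall>k<Suc n. P k) \<longleftrightarrow> P 0 \<and> (\<forall>k<n. P (Suc k))"
  by (metis Suc_less_eq not0_implies_Suc zero_less_Suc)

lemma first_hits_at_Cons:
  "first_hits_at (Suc u) (Suc T) (x # w) \<longleftrightarrow>
    (if x then first_hits_at u T w else first_hits_at (u + 2) T w)"
  unfolding first_hits_at_def by (auto simp: all_less_Suc_iff)

lemma not_hits_twice_le:
  assumes "\<not> hits_twice u w" "k \<le> length w"
  shows "ht w k \<le> int u"
proof (rule ccontr)
  assume *: "\<not> ?thesis"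
  then obtain k' where k': "k = Suc k'" by (metis ht_0 not0_implies_Suc of_nat_0_le_iff)
  have "ht w k \<le> ht w k' + 1" using ht_le[of k' k w] k' by simp
  then have "hits_twice u w" unfolding hits_twice_def
    using * k' assms(2) by (intro exI[of _ k'] exI[of _ k]) auto
  then show False using assms(1) by simp
qed

text \<open>Take the least \<open>u\<close> such that some walk in \<open>Q\<close> stays at or
  below \<open>u\<close>; by minimality no walk in \<open>Q\<close> stays strictly below it. Applied
  to both families, and to the excess walks in \<open>pr_excess_le\<close>.\<close>

lemma max_height_exists:
  assumes "length a = n" "Q a"
  obtains u where "\<And>w. length w = n \<Longrightarrow> Q w \<Longrightarrow> hits u w"
    and "\<exists>w. length w = n \<and> Q w \<and> (\<forall>k\<le>n. ht w k \<le> int u)"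
proof -
  let ?P = "\<lambda>u. \<exists>w. length w = n \<and> Q w \<and> (\<forall>k\<le>n. ht w k \<le> int u)"
  define u where "u = (LEAST u. ?P u)"
  have "ht a k \<le> int n" if "k \<le> n" for k
    using ht_le_self[of a k] that by linarith
  then have "?P n" using assms by blast
  then have "?P u" unfolding u_def by (rule LeastI)
  moreover have "hits u w" if w: "length w = n" "Q w" for w
  proof (cases u)
    case (Suc i)
    then have "\<not> ?P i" unfolding u_def by (intro not_less_Least) simp
    then have "\<not> (\<forall>k\<le>n. ht w k \<le> int i)" using w by blast
    then obtain k where "k \<le> n" "int i < ht w k" by (meson not_le)
    then show ?thesis using w(1) Suc unfolding hits_def by (intro exI[of _ k]) simp
  qed simp
  ultimately show ?thesis using that by blast
qed

section \<open>Probabilities of walk events\<close>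

text \<open>The probability for independent steps, up with probability \<open>p\<close>.
  Conditioning on the first step makes it fit the Cons rules in inductions on
  \<open>n\<close>.\<close>

fun pr :: "nat \<Rightarrow> real \<Rightarrow> (bool list \<Rightarrow> bool) \<Rightarrow> real" where
  "pr 0 p Q = of_bool (Q [])"
| "pr (Suc n) p Q = p * pr n p (\<lambda>w. Q (True # w)) + (1 - p) * pr n p (\<lambda>w. Q (False # w))"

lemma pr_mono:
  assumes "0 \<le> p" "p \<le> 1" "\<And>w. length w = n \<Longrightarrow> Q w \<Longrightarrow> R w"
  shows "pr n p Q \<le> pr n p R"
  using assms(3)
proof (induction n arbitrary: Q R)
  case (Suc n)
  have "pr n p (\<lambda>w. Q (x # w)) \<le> pr n p (\<lambda>w. R (x # w))" for x
    by (rule Suc.IH) (use Suc.prems in simp)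
  then show ?case using assms(1,2) by (auto intro!: add_mono mult_left_mono)
qed (auto simp: of_bool_def)

lemma pr_cong:
  assumes "\<And>w. length w = n \<Longrightarrow> Q w = R w"
  shows "pr n p Q = pr n p R"
  using assms
proof (induction n arbitrary: Q R)
  case (Suc n)
  have "pr n p (\<lambda>w. Q (x # w)) = pr n p (\<lambda>w. R (x # w))" for x
    by (rule Suc.IH) (use Suc.prems in simp)
  then show ?case by simp
qed simp

lemma pr_split: "pr n p Q = pr n p (\<lambda>w. Q w \<and> R w) + pr n p (\<lambda>w. Q w \<and> \<not> R w)"
proof (induction n arbitrary: Q R)
  case (Suc n)
  show ?case
    by (simp add: Suc[of "\<lambda>w. Q (True # w)" "\<lambda>w. R (True # w)"]
        Suc[of "\<lambda>w. Q (False # w)" "\<lambda>w. R (False # w)"] algebra_simps)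
qed auto

lemma pr_True [simp]: "pr n p (\<lambda>w. True) = 1"
  by (induction n) auto

lemma pr_False [simp]: "pr n p (\<lambda>w. False) = 0"
  by (induction n) auto

lemma pr_nonneg: "0 \<le> p \<Longrightarrow> p \<le> 1 \<Longrightarrow> 0 \<le> pr n p Q"
  using pr_mono[of p n "\<lambda>w. False" Q] by simp

lemma pr_le_1: "0 \<le> p \<Longrightarrow> p \<le> 1 \<Longrightarrow> pr n p Q \<le> 1"
  using pr_mono[of p n Q "\<lambda>w. True"] by simp

section \<open>First-passage probabilities and ballot numbers\<close>

fun first_passage :: "real \<Rightarrow> nat \<Rightarrow> nat \<Rightarrow> real" where
  "first_passage p 0 0 = 1"
| "first_passage p 0 (Suc T) = 0"
| "first_passage p (Suc u) 0 = 0"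
| "first_passage p (Suc u) (Suc T) = p * first_passage p u T + (1 - p) * first_passage p (u + 2) T"

lemma first_passage_nonneg: "0 \<le> p \<Longrightarrow> p \<le> 1 \<Longrightarrow> 0 \<le> first_passage p u T"
  by (induction p u T rule: first_passage.induct) auto

text \<open>The number of walks that first reach height \<open>u\<close> with exactly \<open>s\<close> down-steps.\<close>

fun ballot :: "nat \<Rightarrow> nat \<Rightarrow> nat" where
  "ballot u 0 = 1"
| "ballot 0 (Suc s) = 0"
| "ballot (Suc u) (Suc s) = ballot u (Suc s) + ballot (u + 2) s"

lemma first_passage_diag: "first_passage p u u = p ^ u"
proof -
  have aux: "first_passage p u T = 0" if "T < u" for u T
    using that by (induction p u T rule: first_passage.induct) auto
  show ?thesis by (induction u) (auto simp: aux)
qed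

lemma first_passage_ballot:
  fixes p :: real
  shows
  "first_passage p u (u + 2 * s) = ballot u s * p ^ (u + s) * (1 - p) ^ s"
proof (induction u s rule: ballot.induct)
  case (1 u)
  then show ?case by (simp add: first_passage_diag)
next
  case (3 u s)
  have "Suc u + 2 * Suc s = Suc (u + 2 * Suc s)" "u + 2 * Suc s = u + 2 + 2 * s" by simp_all
  then have "first_passage p (Suc u) (Suc u + 2 * Suc s) =
      p * first_passage p u (u + 2 * Suc s) + (1 - p) * first_passage p (u + 2) (u + 2 + 2 * s)"
    by (metis first_passage.simps(4))
  also have "\<dots> = p * (ballot u (Suc s) * p ^ (u + Suc s) * (1 - p) ^ Suc s) +
      (1 - p) * (ballot (u + 2) s * p ^ (u + 2 + s) * (1 - p) ^ s)"
    by (simp only: 3)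
  also have "\<dots> = ballot (Suc u) (Suc s) * p ^ (Suc u + Suc s) * (1 - p) ^ Suc s"
    by (simp add: distrib_left distrib_right mult_ac)
  finally show ?case .
qed simp

lemma ballot_1: "ballot u (Suc 0) = u"
  by (induction u) auto

lemma ballot_2: "2 * ballot u 2 = u * (u + 3)"
  by (induction u) (auto simp: numeral_2_eq_2 ballot_1 algebra_simps)

text \<open>The hitting time formula: \<open>ballot u s\<close> is \<open>u / (u + 2 * s)\<close>
  times the binomial coefficient of \<open>u + 2 * s\<close> over \<open>s\<close>, cleared of
  denominators to stay in the naturals.\<close>

lemma ballot_closed:
  "(u + 2 * s) * ballot u s * (fact s * fact (u + s)) = u * (fact (u + 2 * s) :: nat)"
proof (induction u s rule: ballot.induct)
  case (3 u s)
  let ?N = "u + 2 * s + 2" and ?b = "ballot u (Suc s)" and ?c = "ballot (u + 2) s"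
  let ?f = "fact s * fact (u + s + 1) :: nat" and ?M = "fact (u + 2 * s + 2) :: nat"
  have b: "?N * ?b * (s + 1) * ?f = u * ?M"
    using 3(1) by (simp add: algebra_simps)
  have c: "?N * ?c * (u + s + 2) * ?f = (u + 2) * ?M"
    using 3(2) by (simp add: algebra_simps)
  have "?N * ((?b + ?c) * (s + 1) * (u + s + 2) * ?f) =
      (u + s + 2) * (?N * ?b * (s + 1) * ?f) + (s + 1) * (?N * ?c * (u + s + 2) * ?f)"
    by algebra
  also have "\<dots> = (u + s + 2) * (u * ?M) + (s + 1) * ((u + 2) * ?M)"
    by (simp only: b c)
  also have "\<dots> = ?N * ((u + 1) * ?M)" by algebra
  finally have "(?b + ?c) * (s + 1) * (u + s + 2) * ?f = (u + 1) * ?M"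
    by (subst (asm) mult_cancel1) simp
  then have "(?N + 1) * ((?b + ?c) * (s + 1) * (u + s + 2) * ?f) = (?N + 1) * ((u + 1) * ?M)"
    by simp
  then show ?case by (simp add: algebra_simps)
qed auto

lemma ballot_ratio:
  assumes "0 < u + 2 * s"
  shows "(s + 1) * (u + s + 1) * ballot u (Suc s) = (u + 2 * s + 1) * (u + 2 * s) * ballot u s"
proof -
  let ?N = "u + 2 * s" and ?b = "ballot u (Suc s)" and ?c = "ballot u s"
  let ?f = "fact s * fact (u + s) :: nat" and ?M = "fact (u + 2 * s) :: nat"
  have b: "(?N + 2) * ?b * ((s + 1) * (u + s + 1) * ?f) = u * ((?N + 2) * (?N + 1) * ?M)"
    using ballot_closed[of u "Suc s"] by (simp add: algebra_simps)
  have c: "?N * ?c * ?f = u * ?M" by (rule ballot_closed)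
  have "(?N + 2) * ?f * ((s + 1) * (u + s + 1) * ?b) = (?N + 2) * (?N + 1) * (u * ?M)"
    using b by algebra
  also have "\<dots> = (?N + 2) * ?f * ((?N + 1) * ?N * ?c)"
    unfolding c[symmetric] by algebra
  finally show ?thesis by (subst (asm) mult_cancel1) simp
qed

text \<open>By \<open>first_passage_ballot\<close> the left side is a first-passage probability at
  level \<open>t - d\<close> divided by \<open>p ^ (t - d)\<close>. Two down-steps are handled by
  \<open>ballot_2\<close>, whose denominator gives the 1/2; each further down-step multiplies the
  weight by at most \<open>(t + 2) * p * (1 - p) \<le> 1\<close>.\<close>

lemma ballot_weight_le_half:
  fixes p :: real
  assumes t: "14 \<le> t" and p: "0 \<le> p" "p * (real t + 1) \<le> 1"
  shows "ballot (t - d) (s + 2) * (p * (1 - p)) ^ (s + 2) \<le> (1 - p) ^ d / 2"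
proof -
  let ?X = "p * (1 - p)"
  have "p * 15 \<le> p * (real t + 1)" using t p(1) by (intro mult_left_mono) auto
  from order_trans[OF this p(2)] have p15: "p \<le> 1 / 15" by simp
  have "?X * (real t + 2) = (p * (real t + 1)) * (1 - p) + p * (1 - p)" by algebra
  also have "\<dots> \<le> 1 * (1 - p) + p * (1 - p)" using p p15 by (intro add_mono mult_right_mono) auto
  also have "\<dots> \<le> 1" by (simp add: algebra_simps)
  finally have X: "?X * (real t + 2) \<le> 1" .
  have X0: "0 \<le> ?X" using p p15 by simp
  show ?thesis
  proof (induction s)
    case 0
    have "real ((t - d) * (t - d + 3)) * ?X\<^sup>2 \<le> (1 - p) ^ d"
    proof (induction d)
      case 0
      have "real (t * (t + 3)) \<le> (real t + 2)\<^sup>2" by (simp add: algebra_simps power2_eq_square)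
      then have "real (t * (t + 3)) * ?X\<^sup>2 \<le> (real t + 2)\<^sup>2 * ?X\<^sup>2"
        by (rule mult_right_mono) simp
      also have "\<dots> = (?X * (real t + 2))\<^sup>2" by algebra
      also have "\<dots> \<le> 1" using X X0 by (intro power_le_one) auto
      finally show ?case by simp
    next
      case (Suc d)
      show ?case
      proof (cases "d < t")
        case False
        then show ?thesis using p15 by simp
      next
        case True
        define u where "u = t - Suc d"
        have u: "t - d = u + 1" "u + 1 \<le> t" using True by (auto simp: u_def)
        \<comment> \<open>Lowering the level from \<open>u + 1\<close> to \<open>u\<close> has to
          gain a factor \<open>1 - p\<close>. As \<open>1 - p\<close> is at least
          \<open>(u + 1) / (u + 2)\<close>, this reduces to a polynomial inequality in
          \<open>u\<close>.\<close>
        have "p * (real u + 2) \<le> p * (real t + 1)" using u(2) p(1) by (intro mult_left_mono) auto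
        then have pu: "p * (real u + 2) \<le> 1" using p(2) by linarith
        then have "(real u + 1) \<le> (1 - p) * (real u + 2)" by (simp add: algebra_simps)
        then have "(real u + 1) * ((real u + 1) * (real u + 4)) \<le> (1 - p) * (real u + 2) * ((real u + 1) * (real u + 4))"
          by (intro mult_right_mono) auto
        moreover have "(real u + 2) * (real u * (real u + 3)) \<le> (real u + 1) * ((real u + 1) * (real u + 4))"
          by (simp add: algebra_simps)
        ultimately have "(real u + 2) * (real u * (real u + 3)) \<le>
            (1 - p) * (real u + 2) * ((real u + 1) * (real u + 4))"
          by (rule order_trans[rotated])
        also have "\<dots> = (real u + 2) * ((1 - p) * ((real u + 1) * (real u + 4)))" by algebra
        finally have "(real u + 2) * (real u * (real u + 3)) \<le>
            (real u + 2) * ((1 - p) * ((real u + 1) * (real u + 4)))" .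
        then have "real u * (real u + 3) \<le> (1 - p) * ((real u + 1) * (real u + 4))"
          by (rule mult_left_le_imp_le) simp
        then have "real u * (real u + 3) * ?X\<^sup>2 \<le> (1 - p) * ((real u + 1) * (real u + 4)) * ?X\<^sup>2"
          by (intro mult_right_mono) auto
        also have "\<dots> = (1 - p) * (real ((t - d) * (t - d + 3)) * ?X\<^sup>2)"
          unfolding u(1) by (simp add: algebra_simps)
        also have "\<dots> \<le> (1 - p) * (1 - p) ^ d"
          using Suc p15 by (intro mult_left_mono) auto
        finally show ?thesis unfolding u_def[symmetric] by simp
      qed
    qed
    then show ?case using ballot_2[of "t - d", symmetric] by (simp add: numeral_2_eq_2)
  next
    case (Suc s)
    define u r where "u = t - d" and "r = s + 2"
    have u: "u \<le> t" by (simp add: u_def)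
    \<comment> \<open>Bounds the quotient of consecutive ballot numbers from
      \<open>ballot_ratio\<close> by \<open>t + 2\<close>, using \<open>r \<ge> 2\<close>.\<close>
    have "(u + 2 * r + 1) * (u + 2 * r) \<le> (u + 2 * r + 1) * (2 * (u + r + 1))"
      by (intro mult_left_mono) auto
    also have "\<dots> = 2 * (u + 2 * r + 1) * (u + r + 1)" by algebra
    also have "\<dots> \<le> (t + 2) * (r + 1) * (u + r + 1)"
    proof (rule mult_le_mono1)
      obtain t' where t': "t = t' + 14" using t by (metis add.commute le_Suc_ex)
      show "2 * (u + 2 * r + 1) \<le> (t + 2) * (r + 1)" using u unfolding t' r_def by (simp add: algebra_simps)
    qed
    finally have "(u + 2 * r + 1) * (u + 2 * r) \<le> (t + 2) * (r + 1) * (u + r + 1)" .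
    then have "(u + 2 * r + 1) * (u + 2 * r) * ballot u r \<le> (t + 2) * (r + 1) * (u + r + 1) * ballot u r"
      by (rule mult_le_mono1)
    then have "(r + 1) * (u + r + 1) * ballot u (Suc r) \<le> (t + 2) * (r + 1) * (u + r + 1) * ballot u r"
      using ballot_ratio[of u r] by (simp add: r_def)
    then have "(r + 1) * (u + r + 1) * ballot u (Suc r) \<le> (r + 1) * (u + r + 1) * ((t + 2) * ballot u r)"
      by (simp only: mult_ac)
    then have "ballot u (Suc r) \<le> (t + 2) * ballot u r"
      by (subst (asm) mult_le_cancel1) simp
    then have "real (ballot u (Suc r)) \<le> real ((t + 2) * ballot u r)" by (rule of_nat_mono)
    then have "ballot u (Suc r) * ?X ^ Suc r \<le> real ((t + 2) * ballot u r) * ?X ^ Suc r"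
      using X0 by (intro mult_right_mono) auto
    also have "\<dots> = (?X * (real t + 2)) * (ballot u r * ?X ^ r)"
    proof -
      have "real ((t + 2) * ballot u r) = (real t + 2) * ballot u r" by (simp add: algebra_simps)
      then show ?thesis by (simp only: power_Suc mult_ac)
    qed
    also have "\<dots> \<le> 1 * (ballot u r * ?X ^ r)" using X X0 by (intro mult_right_mono) auto
    finally show ?case using Suc unfolding r_def u_def by simp
  qed
qed

text \<open>
  After scaling by \<open>(1 - p)^d\<close> the recursion in \<open>d\<close> is a convex combination, which propagates the
  bound from \<open>d = 0\<close>.
\<close>

lemma ballot_weight_le_1:
  fixes p :: real
  assumes t: "14 \<le> t" and p: "0 \<le> p" "p * (real t + 1) \<le> 1"
  shows "ballot (t + d) s * (p * (1 - p)) ^ s * (1 - p) ^ d \<le> 1"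
proof (induction s arbitrary: d)
  case 0
  have "p * 1 \<le> p * (real t + 1)" using p(1) by (intro mult_left_mono) auto
  from order_trans[OF this p(2)] show ?case using p by (simp add: power_le_one)
next
  case (Suc s)
  note IH = Suc.IH
  have "p * 1 \<le> p * (real t + 1)" using p(1) by (intro mult_left_mono) auto
  from order_trans[OF this p(2)] have p1: "p \<le> 1" by simp
  show ?case
  proof (induction d)
    case 0
    show ?case
    proof (cases s)
      case 0
      have "t * (p * (1 - p)) = (p * t) * (1 - p)" by simp
      also have "\<dots> \<le> 1 * 1" using p p1 by (intro mult_mono) (auto simp: algebra_simps)
      finally show ?thesis using 0 by (simp add: ballot_1)
    next
      case (Suc s')
      then show ?thesis using ballot_weight_le_half[OF t p, of 0 s'] by simp
    qed
  next
    case (Suc d)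
    let ?w = "\<lambda>d s. ballot (t + d) s * (p * (1 - p)) ^ s * (1 - p) ^ d"
    have "?w (Suc d) (Suc s) = (1 - p) * ?w d (Suc s) + p * ?w (d + 2) s"
      by (simp add: algebra_simps)
    also have "\<dots> \<le> (1 - p) * 1 + p * 1"
      using p p1 by (intro add_mono mult_left_mono Suc.IH IH[of "d + 2"]) auto
    finally show ?case by simp
  qed
qed

section \<open>Probability bounds for hitting a level, for fixed small p\<close>

context
  fixes p :: real
  assumes p0: "0 < p" and p15: "p \<le> 1 / 15"
begin

text \<open>The gambler's ruin probability that an infinite walk ever climbs one level: the root
  below 1 of \<open>x = p + (1 - p) * x * x\<close>, which is what \<open>alpha_step\<close>
  expresses.\<close>

private definition "\<alpha> = p / (1 - p)"

lemma alpha_step: "p * \<alpha> ^ u + (1 - p) * \<alpha> ^ (u + 2) = \<alpha> ^ Suc u"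
proof -
  have "1 - p \<noteq> 0" using p15 by simp
  then have "p + (1 - p) * (\<alpha> * \<alpha>) = \<alpha>" by (simp add: \<alpha>_def divide_simps) algebra
  then have "\<alpha> ^ u * (p + (1 - p) * (\<alpha> * \<alpha>)) = \<alpha> ^ u * \<alpha>" by simp
  then show ?thesis by (simp add: algebra_simps)
qed

lemma p_facts: "0 \<le> p" "p \<le> 1" "0 < 1 - p" "0 < \<alpha>" "\<alpha> \<le> 1 / 14" "(1 - p) * \<alpha> = p"
  using p0 p15 by (auto simp: \<alpha>_def field_simps)

lemma pr_hits_le: "pr n p (hits u) \<le> \<alpha> ^ u"
proof (induction n arbitrary: u)
  case 0
  show ?case
    using p_facts(4) by (cases u) (auto simp: hits_def)
next
  case (Suc n)
  show ?case
  proof (cases u)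
    case 0
    then show ?thesis using pr_le_1[OF p_facts(1,2), of "Suc n" "hits 0"] by simp
  next
    case (Suc u')
    have "pr (Suc n) p (hits u) = p * pr n p (hits u') + (1 - p) * pr n p (hits (u' + 2))"
      unfolding Suc by (simp add: hits_Cons)
    also have "\<dots> \<le> p * \<alpha> ^ u' + (1 - p) * \<alpha> ^ (u' + 2)"
      by (intro add_mono mult_left_mono Suc.IH p_facts(1) less_imp_le[OF p_facts(3)])
    finally show ?thesis using alpha_step[of u'] Suc by simp
  qed
qed

text \<open>Once the level is reached, a second hit comes from an up-step, with probability
  \<open>p\<close>, or from a down-step and a return, with probability at most
  \<open>(1 - p) * \<alpha> = p\<close>.\<close>

lemma pr_hits_twice_le: "pr n p (hits_twice u) \<le> 2 * p * \<alpha> ^ u"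
proof (induction n arbitrary: u)
  case 0
  show ?case
    using p_facts by (auto simp: hits_twice_def)
next
  case (Suc n)
  show ?case
  proof (cases u)
    case 0
    have "pr n p (\<lambda>w. hits_twice 0 (False # w)) \<le> pr n p (hits 1)"
      using p_facts hits_twice_0_Cons by (intro pr_mono) auto
    also have "\<dots> \<le> \<alpha>" using pr_hits_le[of n 1] by simp
    finally have "(1 - p) * pr n p (\<lambda>w. hits_twice 0 (False # w)) \<le> p"
      using mult_left_mono[of _ \<alpha> "1 - p"] p_facts by fastforce
    moreover have "p * pr n p (\<lambda>w. hits_twice 0 (True # w)) \<le> p * 1"
      using p_facts pr_le_1 by (intro mult_left_mono) auto
    ultimately show ?thesis using 0 by simp
  next
    case (Suc u')
    have "pr (Suc n) p (hits_twice u) = p * pr n p (hits_twice u') + (1 - p) * pr n p (hits_twice (u' + 2))"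
      unfolding Suc by (simp add: hits_twice_Cons)
    also have "\<dots> \<le> p * (2 * p * \<alpha> ^ u') + (1 - p) * (2 * p * \<alpha> ^ (u' + 2))"
      by (intro add_mono mult_left_mono Suc.IH p_facts(1) less_imp_le[OF p_facts(3)])
    also have "\<dots> = 2 * p * (p * \<alpha> ^ u' + (1 - p) * \<alpha> ^ (u' + 2))" by (simp add: algebra_simps)
    finally show ?thesis using alpha_step[of u'] Suc by simp
  qed
qed

text \<open>Write \<open>f\<close> for \<open>first_passage p u T\<close>. First passages at times
  other than \<open>T\<close> have total weight at most \<open>\<alpha> ^ u - f\<close>, and a
  fraction of at most \<open>2 * p\<close> of them is followed by a second hit; those at
  \<open>T\<close> count fully. The sum is the stated bound.\<close>

lemma pr_hits_twice_or_first_le: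
  "pr n p (\<lambda>w. hits_twice u w \<or> first_hits_at u T w) \<le> 2 * p * \<alpha> ^ u + (1 - 2 * p) * first_passage p u T"
proof (induction n arbitrary: u T)
  case 0
  have "0 \<le> 2 * p * \<alpha> ^ u + (1 - 2 * p) * first_passage p u T"
    using p_facts p15 first_passage_nonneg[of p u T] by (intro add_nonneg_nonneg mult_nonneg_nonneg) auto
  moreover have "\<not> hits_twice u []" by (simp add: hits_twice_def)
  moreover have "u = 0 \<and> T = 0" if "first_hits_at u T []" using that by (simp add: first_hits_at_def)
  ultimately show ?case by fastforce
next
  case (Suc n)
  show ?case
  proof (cases u)
    case 0
    then show ?thesis
      using pr_le_1[OF p_facts(1,2), of "Suc n"] pr_hits_twice_le[of "Suc n" 0] p_facts
      by (cases T) (auto simp del: pr.simps)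
  next
    case u: (Suc u')
    show ?thesis
    proof (cases T)
      case 0
      then show ?thesis using u pr_hits_twice_le[of "Suc n" u] p_facts by (simp del: pr.simps)
    next
      case (Suc T')
      have "pr (Suc n) p (\<lambda>w. hits_twice u w \<or> first_hits_at u T w) =
          p * pr n p (\<lambda>w. hits_twice u' w \<or> first_hits_at u' T' w) +
          (1 - p) * pr n p (\<lambda>w. hits_twice (u' + 2) w \<or> first_hits_at (u' + 2) T' w)"
        unfolding Suc u by (simp add: hits_twice_Cons first_hits_at_Cons)
      also have "\<dots> \<le> p * (2 * p * \<alpha> ^ u' + (1 - 2 * p) * first_passage p u' T') +
          (1 - p) * (2 * p * \<alpha> ^ (u' + 2) + (1 - 2 * p) * first_passage p (u' + 2) T')"
        by (intro add_mono mult_left_mono Suc.IH p_facts(1) less_imp_le[OF p_facts(3)])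
      also have "\<dots> = 2 * p * (p * \<alpha> ^ u' + (1 - p) * \<alpha> ^ (u' + 2)) + (1 - 2 * p) * first_passage p u T"
        using u Suc by (simp add: algebra_simps)
      finally show ?thesis using alpha_step[of u'] u by simp
    qed
  qed
qed

text \<open>
  Contains the walks that first reach \<open>v\<close> at time \<open>T\<close>, step down \<open>j + 1\<close> times and never return to
  \<open>v - j\<close>. The stepwise condition \<open>ht w k + k \<le> v + T\<close> forbids any up-step during the descent.
\<close>

definition evades :: "nat \<Rightarrow> nat \<Rightarrow> nat \<Rightarrow> bool list \<Rightarrow> bool" where
  "evades v T j w \<longleftrightarrow> ht w T = int v \<and> (\<forall>k<T. ht w k < int v) \<and>
    (\<forall>k. T \<le> k \<and> k \<le> length w \<longrightarrow> ht w k + int k \<le> int v + int T \<or> ht w k < int v - int j)"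

lemma all_le_Suc_iff: "(\<forall>k\<le>Suc n. P k) \<longleftrightarrow> P 0 \<and> (\<forall>k\<le>n. P (Suc k))"
  using ex_le_Suc_iff[of n "\<lambda>k. \<not> P k"] by blast

text \<open>Make \<open>j + 1\<close> down-steps and then never climb one level; the last down-step
  and the avoidance together cost \<open>(1 - p) * (1 - \<alpha>) = 1 - 2 * p\<close>.\<close>

lemma pr_descend_ge:
  "(1 - 2 * p) * (1 - p) ^ j \<le> pr n p (\<lambda>w. \<forall>k\<le>length w. ht w k + int k \<le> 0 \<or> ht w k < - int j)"
    (is "_ \<le> pr n p (?D j)")
proof (induction j arbitrary: n)
  case 0
  show ?case
  proof (cases n)
    case 0
    then show ?thesis using p0 by simp
  next
    case (Suc m)
    have "pr m p (\<lambda>w. True) = pr m p (\<lambda>w. True \<and> hits 1 w) + pr m p (\<lambda>w. True \<and> \<not> hits 1 w)"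
      by (rule pr_split)
    then have "1 - \<alpha> \<le> pr m p (\<lambda>w. \<not> hits 1 w)" using pr_hits_le[of m 1] by simp
    also have "\<dots> \<le> pr m p (\<lambda>w. ?D 0 (False # w))"
    proof (intro pr_mono p_facts(1,2))
      fix w assume "\<not> hits 1 w"
      then have "ht w k < 1" if "k \<le> length w" for k using that unfolding hits_def by force
      then have "ht (False # w) k + int k \<le> 0 \<or> ht (False # w) k < - int 0"
        if "k \<le> Suc (length w)" for k using that by (cases k) force+
      then show "?D 0 (False # w)" by simp
    qed
    finally have "(1 - p) * (1 - \<alpha>) \<le> (1 - p) * pr m p (\<lambda>w. ?D 0 (False # w))"
      using p_facts by (intro mult_left_mono) auto
    also have "\<dots> \<le> pr n p (?D 0)"
      using Suc p_facts pr_nonneg[OF p_facts(1,2)] by simp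
    finally show ?thesis using p_facts(6) by (simp add: algebra_simps)
  qed
next
  case (Suc j)
  show ?case
  proof (cases n)
    case 0
    have "(1 - p) ^ j \<le> 1" using p_facts by (intro power_le_one) auto
    then have "(1 - 2 * p) * (1 - p) ^ Suc j \<le> 1 * 1"
      using p_facts p15 by (intro mult_mono power_le_one) auto
    then show ?thesis using 0 by simp
  next
    case (Suc m)
    have "(1 - 2 * p) * (1 - p) ^ j \<le> pr m p (?D j)" by (rule Suc.IH)
    also have "\<dots> \<le> pr m p (\<lambda>w. ?D (Suc j) (False # w))"
      using p_facts by (intro pr_mono) (auto simp: all_le_Suc_iff)
    finally have "(1 - p) * ((1 - 2 * p) * (1 - p) ^ j) \<le> (1 - p) * pr m p (\<lambda>w. ?D (Suc j) (False # w))"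
      using p_facts by (intro mult_left_mono) auto
    also have "\<dots> \<le> pr n p (?D (Suc j))"
      using Suc p_facts pr_nonneg[OF p_facts(1,2)] by simp
    finally show ?thesis by (simp add: mult_ac)
  qed
qed

lemma evades_Cons:
  "evades (Suc v) (Suc T) j (x # w) \<longleftrightarrow> (if x then evades v T j w else evades (v + 2) T j w)"
proof -
  have "(\<forall>k. Suc T \<le> k \<and> k \<le> length (x # w) \<longrightarrow> P k) \<longleftrightarrow> (\<forall>k. T \<le> k \<and> k \<le> length w \<longrightarrow> P (Suc k))" for P
    by (metis Suc_le_D Suc_le_mono length_Cons)
  then show ?thesis unfolding evades_def
    by (auto simp: all_less_Suc_iff algebra_simps)
qed

lemma pr_evades_ge:
  "T \<le> n \<Longrightarrow> first_passage p v T * ((1 - 2 * p) * (1 - p) ^ j) \<le> pr n p (evades v T j)"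
proof (induction T arbitrary: n v)
  case 0
  show ?case
  proof (cases v)
    case 0
    have "(\<lambda>w. \<forall>k\<le>length w. ht w k + int k \<le> 0 \<or> ht w k < - int j) = evades 0 0 j"
      by (rule ext) (auto simp: evades_def)
    then show ?thesis using 0 pr_descend_ge[of j n] by simp
  next
    case (Suc v')
    then show ?thesis using pr_nonneg[OF p_facts(1,2)] by simp
  qed
next
  case (Suc T)
  then obtain m where n: "n = Suc m" "T \<le> m" by (metis Suc_le_D Suc_le_mono)
  show ?case
  proof (cases v)
    case 0
    then show ?thesis using pr_nonneg[OF p_facts(1,2)] by simp
  next
    case v: (Suc v')
    let ?c = "(1 - 2 * p) * (1 - p) ^ j"
    have "first_passage p v (Suc T) * ?c =
        p * (first_passage p v' T * ?c) + (1 - p) * (first_passage p (v' + 2) T * ?c)"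
      using v by (simp add: algebra_simps)
    also have "\<dots> \<le> p * pr m p (evades v' T j) + (1 - p) * pr m p (evades (v' + 2) T j)"
      by (intro add_mono mult_left_mono Suc.IH n(2) p_facts(1) less_imp_le[OF p_facts(3)])
    also have "\<dots> = pr n p (evades v (Suc T) j)"
      using n v by (simp add: evades_Cons)
    finally show ?thesis .
  qed
qed

text \<open>Let \<open>u + j\<close> be the highest level reached by every excess walk of
  \<open>A\<close>. A larger \<open>j\<close> makes the excess rarer, but also makes the walks
  barred from \<open>B\<close> rarer. Both bounds carry the factor \<open>(1 - p) ^ j\<close>, so
  the comparison is uniform in \<open>j\<close>.\<close>

lemma pr_excess_le:
  fixes A B :: "bool list \<Rightarrow> bool"
  assumes uv: "u + v = 2 * t"
    and cross: "\<And>a b. length a = n \<Longrightarrow> length b = n \<Longrightarrow> A a \<Longrightarrow> B b \<Longrightarrow>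
      \<exists>k\<le>n. 2 * int t \<le> ht a k + ht b k"
    and hit: "\<And>a. length a = n \<Longrightarrow> A a \<Longrightarrow> hits u a"
    and single: "\<And>a. length a = n \<Longrightarrow> A a \<Longrightarrow> \<not> hits_twice u a \<Longrightarrow> int u \<le> ht a T"
    and T: "T \<le> n" "T \<le> u + 2" "even (T + u)"
  shows "pr n p (\<lambda>w. A w \<and> ht w T < int u) * ((1 - 2 * p) * first_passage p v T)
    \<le> 2 * p * \<alpha> ^ u * pr n p (\<lambda>w. int v \<le> ht w T \<and> \<not> B w)"
proof (cases "\<exists>a. length a = n \<and> A a \<and> ht a T < int u")
  case False
  then have "pr n p (\<lambda>w. A w \<and> ht w T < int u) = pr n p (\<lambda>w. False)"
    by (intro pr_cong) blast
  then show ?thesis using p_facts pr_nonneg by simp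
next
  case True
  then obtain w where "length w = n" "A w \<and> ht w T < int u" by blast
  then obtain x where x: "\<And>w. length w = n \<Longrightarrow> A w \<and> ht w T < int u \<Longrightarrow> hits x w"
    and "\<exists>a. length a = n \<and> (A a \<and> ht a T < int u) \<and> (\<forall>k\<le>n. ht a k \<le> int x)"
    by (rule max_height_exists) blast
  then obtain a where a: "length a = n" "A a" "ht a T < int u" and ax: "\<And>k. k \<le> n \<Longrightarrow> ht a k \<le> int x"
    by blast
  obtain k where "k \<le> n" "int u \<le> ht a k" using hit[OF a(1,2)] a(1) unfolding hits_def by blast
  then have "u \<le> x" using ax[of k] by linarith
  then obtain j where j: "x = u + j" by (metis le_Suc_ex)
  have least: "hits (u + j) w" if "length w = n" "A w" "ht w T < int u" for w
    using x that unfolding j by blast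
  have excess: "pr n p (\<lambda>w. A w \<and> ht w T < int u) \<le> 2 * p * \<alpha> ^ u * (1 - p) ^ j"
  proof (cases j)
    case 0
    have "pr n p (\<lambda>w. A w \<and> ht w T < int u) \<le> pr n p (hits_twice u)"
      using p_facts single by (intro pr_mono) (auto simp: not_le[symmetric])
    then show ?thesis using 0 pr_hits_twice_le[of n u] by simp
  next
    case (Suc i)
    have "pr n p (\<lambda>w. A w \<and> ht w T < int u) \<le> pr n p (hits (u + j))"
      using p_facts least by (intro pr_mono) auto
    also have "\<dots> \<le> \<alpha> ^ (u + j)" by (rule pr_hits_le)
    also have "\<dots> = \<alpha> ^ u * (\<alpha> * \<alpha> ^ i)" using Suc by (simp add: power_add)
    also have "\<dots> \<le> \<alpha> ^ u * (2 * p * (1 - p) * (1 - p) ^ i)"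
    proof -
      \<comment> \<open>One factor \<open>\<alpha>\<close> has to pay for the constant
        \<open>2 * p\<close>; this amounts to \<open>1 \<le> 2 * (1 - p) * (1 - p)\<close>.\<close>
      have "(1 - p) * (1 - p) \<ge> (14 / 15) * (14 / 15)" using p15 by (intro mult_mono) auto
      then have "p * 1 \<le> p * (2 * ((1 - p) * (1 - p)))" using p0 by (intro mult_left_mono) auto
      then have "\<alpha> \<le> 2 * p * (1 - p)" using p_facts(3) by (simp add: \<alpha>_def field_simps)
      moreover have "\<alpha> \<le> 1 - p" using p_facts(5) p15 by linarith
      ultimately show ?thesis using p_facts by (intro mult_left_mono mult_mono power_mono) auto
    qed
    also have "\<dots> = 2 * p * \<alpha> ^ u * (1 - p) ^ j" by (simp only: Suc power_Suc mult_ac)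
    finally show ?thesis .
  qed
  have killed: "\<not> B w" if w: "length w = n" "evades v T j w" for w
  proof
    assume "B w"
    then obtain k where k: "k \<le> n" "2 * int t \<le> ht a k + ht w k"
      using cross[OF a(1) w(1) a(2)] by blast
    have uv': "2 * int t = int u + int v" using uv by linarith
    have par: "even (ht a T + int T)" using ht_parity[of T a] a(1) T(1) by simp
    have evu: "even (int T + int u)" using T(3) by (metis even_of_nat of_nat_add)
    \<comment> \<open>Parity improves "below \<open>u\<close>" to a gap of 2. From \<open>T\<close>
      on, \<open>a\<close> can gain only what a purely descending walk loses, so the sum stays at
      most \<open>2 * t - 2\<close> throughout the descent.\<close>
    have aT: "ht a T \<le> int u - 2" using par evu a(3) by presburger
    show False
    proof (cases "k < T")
      case True
      have "ht w k < int v" using w(2) True unfolding evades_def by blast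
      \<comment> \<open>Since \<open>k < T \<le> u + 2\<close>, the walk \<open>a\<close> can exceed
        \<open>u\<close> only at time \<open>u + 1\<close>, with \<open>T = u + 2\<close>. One more
        step leaves it at \<open>u\<close> or higher at time \<open>T\<close>, a
        contradiction.\<close>
      moreover have "ht a k \<le> int u"
      proof (rule ccontr)
        assume "\<not> ht a k \<le> int u"
        then have *: "ht a k = int u + 1" "k = u + 1"
          using ht_le_self[of a k] True T(2) by linarith+
        then have "T = u + 2" using True T(2) by linarith
        then show False using * aT ht_ge[of k T a] by simp
      qed
      ultimately show False using k uv' by linarith
    next
      case False
      then have "ht w k + int k \<le> int v + int T \<or> ht w k < int v - int j"
        using w k(1) unfolding evades_def by auto
      moreover have "ht a k \<le> int u - 2 + (int k - int T)"
        using ht_le[of T k a] False aT by auto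
      moreover have "ht a k \<le> int u + int j" using ax[OF k(1)] j by simp
      ultimately show False using k uv' by linarith
    qed
  qed
  have "first_passage p v T * ((1 - 2 * p) * (1 - p) ^ j) \<le> pr n p (evades v T j)"
    by (rule pr_evades_ge[OF T(1)])
  also have "\<dots> \<le> pr n p (\<lambda>w. int v \<le> ht w T \<and> \<not> B w)"
    using p_facts killed by (intro pr_mono) (auto simp: evades_def)
  finally have deficit: "first_passage p v T * ((1 - 2 * p) * (1 - p) ^ j)
    \<le> pr n p (\<lambda>w. int v \<le> ht w T \<and> \<not> B w)" .
  have "pr n p (\<lambda>w. A w \<and> ht w T < int u) * ((1 - 2 * p) * first_passage p v T)
    \<le> 2 * p * \<alpha> ^ u * (1 - p) ^ j * ((1 - 2 * p) * first_passage p v T)"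
    using excess p15 first_passage_nonneg[OF p_facts(1,2)] by (intro mult_right_mono mult_nonneg_nonneg) auto
  also have "\<dots> = 2 * p * \<alpha> ^ u * (first_passage p v T * ((1 - 2 * p) * (1 - p) ^ j))"
    by (simp add: mult_ac)
  also have "\<dots> \<le> 2 * p * \<alpha> ^ u * pr n p (\<lambda>w. int v \<le> ht w T \<and> \<not> B w)"
    using deficit p_facts by (intro mult_left_mono) auto
  finally show ?thesis .
qed

section \<open>Measures of the comparison families and product estimates\<close>

lemma pr_ht_top_le: "u \<le> n \<Longrightarrow> pr n p (\<lambda>w. int u \<le> ht w u) \<le> p ^ u"
proof (induction u arbitrary: n)
  case 0
  then show ?case by simp
next
  case (Suc u)
  then obtain m where n: "n = Suc m" "u \<le> m" by (metis Suc_le_D Suc_le_mono)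
  have "\<not> int (Suc u) \<le> ht (False # w) (Suc u)" for w using ht_le_self[of w u] by simp
  then have "pr n p (\<lambda>w. int (Suc u) \<le> ht w (Suc u)) = p * pr m p (\<lambda>w. int u \<le> ht w u)"
    using n by simp
  also have "\<dots> \<le> p * p ^ u" using Suc.IH n p_facts by (intro mult_left_mono) auto
  finally show ?case by simp
qed

text \<open>The event is at most one down-step among the first \<open>T\<close> steps. For
  \<open>T = t + 2\<close> it describes the Frankl family of sets containing at least
  \<open>t + 1\<close> elements of \<open>{1..t + 2}\<close>.\<close>

lemma pr_ht_second_le:
  "T \<le> n \<Longrightarrow> pr n p (\<lambda>w. int T - 2 \<le> ht w T) \<le> T * p ^ (T - 1) * (1 - p) + p ^ T"
proof (induction T arbitrary: n)
  case 0
  then show ?case by simp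
next
  case (Suc T)
  then obtain m where n: "n = Suc m" "T \<le> m" by (metis Suc_le_D Suc_le_mono)
  have "pr n p (\<lambda>w. int (Suc T) - 2 \<le> ht w (Suc T)) =
      p * pr m p (\<lambda>w. int T - 2 \<le> ht w T) + (1 - p) * pr m p (\<lambda>w. int T \<le> ht w T)"
    using n by (simp add: algebra_simps)
  also have "\<dots> \<le> p * (T * p ^ (T - 1) * (1 - p) + p ^ T) + (1 - p) * p ^ T"
    using Suc.IH n(2) p_facts pr_ht_top_le[OF n(2)] by (intro add_mono mult_left_mono) auto
  also have "\<dots> = Suc T * p ^ (Suc T - 1) * (1 - p) + p ^ Suc T"
    by (cases T) (auto simp: algebra_simps)
  finally show ?case .
qed

lemma alpha_power: "\<alpha> ^ u * (1 - p) ^ u = p ^ u"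
  using p_facts(6) by (metis power_mult_distrib mult.commute)

text \<open>The constant 272/100 bounds \<open>exp 1\<close>: the hypothesis gives
  \<open>1 / (1 - p) \<le> 1 + 1 / t \<le> exp (1 / t)\<close>, so \<open>(1 - p) ^ t\<close> is at
  least \<open>exp (-1)\<close>.\<close>

lemma alpha_power_le:
  assumes "p * (real t + 1) \<le> 1" "0 < t"
  shows "1 \<le> (272 / 100) * (1 - p) ^ t" "\<alpha> ^ t \<le> (272 / 100) * p ^ t"
proof -
  have "real t * (1 / (1 - p)) \<le> real t + 1"
    using assms(1) p_facts(3) by (simp add: field_simps)
  then have "1 / (1 - p) \<le> 1 + 1 / t" using assms(2) by (simp add: field_simps)
  also have "\<dots> \<le> exp (1 / t)" by (rule exp_ge_add_one_self)
  finally have "1 \<le> exp (1 / t) * (1 - p)" using p_facts(3) by (simp add: field_simps)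
  then have "1 ^ t \<le> (exp (1 / t) * (1 - p)) ^ t" by (intro power_mono) auto
  also have "\<dots> = exp 1 * (1 - p) ^ t"
    using assms(2) by (simp add: power_mult_distrib flip: exp_of_nat_mult)
  also have "\<dots> \<le> (272 / 100) * (1 - p) ^ t"
    using e_less_272 p_facts by (intro mult_right_mono) auto
  finally show *: "1 \<le> (272 / 100) * (1 - p) ^ t" by simp
  have "\<alpha> ^ t * 1 \<le> \<alpha> ^ t * ((272 / 100) * (1 - p) ^ t)"
    using * p_facts by (intro mult_left_mono) auto
  then show "\<alpha> ^ t \<le> (272 / 100) * p ^ t" using alpha_power[of t] by (simp add: algebra_simps)
qed

text \<open>Here \<open>f\<close> and \<open>g\<close> are bounds for the comparison families. Each
  excess is charged to the deficit of the other family, which gives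
  \<open>x * g + y * f \<le> 2 * f * g\<close>; the inequality of arithmetic and geometric means for
  \<open>x * g\<close> and \<open>y * f\<close> finishes.\<close>

lemma product_le_of_excess:
  fixes f g x y :: real
  assumes "0 < f" "0 < g" "0 \<le> x" "0 \<le> y"
    and "x \<le> f - defx + excx" "y \<le> g - defy + excy"
    and "excx * g \<le> defy * f" "excy * f \<le> defx * g"
  shows "x * y \<le> f * g"
proof -
  have "x * g \<le> (f - defx + excx) * g" "y * f \<le> (g - defy + excy) * f"
    using assms by (auto intro!: mult_right_mono)
  then have "x * g + y * f \<le> 2 * (f * g)" using assms(7,8) by (simp add: algebra_simps)
  then have sum: "(x * g + y * f) / 2 \<le> f * g" by simp
  have "(x * y) * (f * g) = ((x * g + y * f) / 2)\<^sup>2 - ((x * g - y * f) / 2)\<^sup>2"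
    by (simp add: power2_eq_square field_simps)
  also have "\<dots> \<le> ((x * g + y * f) / 2)\<^sup>2" by simp
  also have "\<dots> \<le> (f * g)\<^sup>2" using sum assms(1-4) by (intro power_mono) auto
  also have "\<dots> = (f * g) * (f * g)" by (rule power2_eq_square)
  finally show ?thesis using mult_pos_pos[OF assms(1,2)] by (rule mult_right_le_imp_le)
qed

text \<open>
  For \<open>u = t - d\<close> and \<open>v = t + d\<close> the two bounds are balanced by the factors \<open>(1 - p)^d\<close> and
  \<open>(1 - p)^(-d)\<close>.
\<close>

lemma late_passage_product_le:
  assumes t: "14 \<le> t" "p * (real t + 1) \<le> 1"
    and uv: "u + v = 2 * t" "u \<le> v" and T: "T = u + 2 * s" "T = v + 2 * r" "2 \<le> s"
    and M: "0 \<le> M" "M \<le> 2 * p * \<alpha> ^ u + (1 - 2 * p) * first_passage p u T"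
    and N: "0 \<le> N" "N \<le> 2 * p * \<alpha> ^ v + (1 - 2 * p) * first_passage p v T"
  shows "M * N \<le> 99 / 100 * (p ^ t)\<^sup>2"
proof -
  define d where "d = t - u"
  have ud: "u = t - d" "u + d = t" and vd: "v = t + d" using uv by (auto simp: d_def)
  let ?q = "1 - p"
  obtain s' where s': "s = s' + 2" using T(3) by (metis add.commute le_Suc_ex)
  have e: "1 \<le> (272 / 100) * ?q ^ t" using alpha_power_le(1)[OF t(2)] t(1) by simp
  have qd: "0 < ?q ^ d" using p_facts by simp
  have pu: "0 \<le> p ^ u" "0 \<le> p ^ v" using p0 by simp_all
  have au: "\<alpha> ^ u \<le> p ^ u * ?q ^ d * (272 / 100)"
  proof -
    have "\<alpha> ^ u * 1 \<le> \<alpha> ^ u * ((272 / 100) * ?q ^ t)" using e p_facts by (intro mult_left_mono) auto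
    also have "\<dots> = (\<alpha> ^ u * ?q ^ u) * ?q ^ d * (272 / 100)" unfolding ud(2)[symmetric] by (simp add: power_add)
    finally show ?thesis by (simp add: alpha_power)
  qed
  have av: "\<alpha> ^ v * ?q ^ d \<le> p ^ v * (272 / 100)"
  proof -
    have "\<alpha> ^ v * ?q ^ d * 1 \<le> \<alpha> ^ v * ?q ^ d * ((272 / 100) * ?q ^ t)"
      using e p_facts by (intro mult_left_mono) auto
    also have "\<dots> = (\<alpha> ^ v * ?q ^ v) * (272 / 100)" unfolding vd by (simp add: power_add)
    finally show ?thesis by (simp add: alpha_power)
  qed
  have fu: "first_passage p u T \<le> p ^ u * ?q ^ d * (1 / 2)"
  proof -
    have "first_passage p u T = p ^ u * (ballot u s * (p * ?q) ^ s)"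
      unfolding T(1) first_passage_ballot by (simp add: power_add power_mult_distrib)
    also have "\<dots> \<le> p ^ u * (?q ^ d / 2)"
      using ballot_weight_le_half[OF t(1) p_facts(1) t(2), of d s'] pu unfolding ud(1) s'
      by (intro mult_left_mono) auto
    finally show ?thesis by simp
  qed
  have fv: "first_passage p v T * ?q ^ d \<le> p ^ v"
  proof -
    have "first_passage p v T * ?q ^ d = p ^ v * (ballot v r * (p * ?q) ^ r * ?q ^ d)"
      unfolding T(2) first_passage_ballot by (simp add: power_add power_mult_distrib)
    also have "\<dots> \<le> p ^ v * 1"
      using ballot_weight_le_1[OF t(1) p_facts(1) t(2), of d r] pu unfolding vd
      by (intro mult_left_mono) auto
    finally show ?thesis by simp
  qed
  let ?a = "2 * p * (272 / 100) + (1 - 2 * p) * (1 / 2)" and ?b = "2 * p * (272 / 100) + (1 - 2 * p)"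
  have "M \<le> 2 * p * (p ^ u * ?q ^ d * (272 / 100)) + (1 - 2 * p) * (p ^ u * ?q ^ d * (1 / 2))"
    using M(2) au fu p0 p15 by (intro order_trans[OF M(2)] add_mono mult_left_mono) auto
  also have "\<dots> = p ^ u * ?q ^ d * ?a" by algebra
  finally have Ma: "M \<le> p ^ u * ?q ^ d * ?a" .
  have "N * ?q ^ d \<le> (2 * p * \<alpha> ^ v + (1 - 2 * p) * first_passage p v T) * ?q ^ d"
    using N qd by (intro mult_right_mono) auto
  also have "\<dots> = 2 * p * (\<alpha> ^ v * ?q ^ d) + (1 - 2 * p) * (first_passage p v T * ?q ^ d)"
    by (simp add: algebra_simps)
  also have "\<dots> \<le> 2 * p * (p ^ v * (272 / 100)) + (1 - 2 * p) * p ^ v"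
    using av fv p0 p15 by (intro add_mono mult_left_mono) auto
  also have "\<dots> = p ^ v * ?b" by algebra
  finally have Nb: "N * ?q ^ d \<le> p ^ v * ?b" .
  have "M * (N * ?q ^ d) \<le> (p ^ u * ?q ^ d * ?a) * (p ^ v * ?b)"
    by (rule mult_mono[OF Ma Nb order_trans[OF M(1) Ma] mult_nonneg_nonneg[OF N(1) less_imp_le[OF qd]]])
  then have "?q ^ d * (M * N) \<le> ?q ^ d * (p ^ u * p ^ v * (?a * ?b))"
    by (simp add: mult_ac)
  then have MN: "M * N \<le> p ^ u * p ^ v * (?a * ?b)" using qd by (rule mult_left_le_imp_le)
  have "p ^ u * p ^ v = (p ^ t)\<^sup>2" using uv(1) by (metis power_add power_mult mult.commute)
  with MN have le: "M * N \<le> (p ^ t)\<^sup>2 * (?a * ?b)" by simp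
  \<comment> \<open>Both factors increase with \<open>p\<close> and are evaluated at 1/15. The 1/2
    from \<open>ballot_weight_le_half\<close>, available because \<open>s \<ge> 2\<close>, is what
    keeps the product below 1.\<close>
  have "?a \<le> 797 / 1000" using p15 by (simp add: field_simps)
  moreover have "?b \<le> 123 / 100" using p15 by simp
  moreover have "0 \<le> ?b" using p0 by simp
  ultimately have "?a * ?b \<le> 797 / 1000 * (123 / 100)" by (intro mult_mono) auto
  then have "(p ^ t)\<^sup>2 * (?a * ?b) \<le> (p ^ t)\<^sup>2 * (99 / 100)" by (intro mult_left_mono) auto
  with le show ?thesis by simp
qed

text \<open>Only \<open>u = v = T = t\<close> leads to the second alternative. Every other
  configuration bounds the product, either by a numerical margin of 1/100 or, when the comparison
  families are not \<open>F0\<close>, by the distance of \<open>p\<close> from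
  \<open>1 / (t + 1)\<close>.\<close>

lemma walk_dichotomy:
  fixes A B :: "bool list \<Rightarrow> bool"
  assumes t: "14 \<le> t" and e: "0 < e" "p * (real t + 1) \<le> 1 - (real t + 1) * e"
    and cross: "\<And>a b. length a = n \<Longrightarrow> length b = n \<Longrightarrow> A a \<Longrightarrow> B b \<Longrightarrow>
      \<exists>k\<le>n. 2 * int t \<le> ht a k + ht b k"
    and hitA: "\<And>a. length a = n \<Longrightarrow> A a \<Longrightarrow> hits u a"
    and hitB: "\<And>b. length b = n \<Longrightarrow> B b \<Longrightarrow> hits v b"
    and uv: "2 * t \<le> u + v" "u \<le> v"
    and \<delta>: "\<delta> \<le> 1 / 100" "\<delta> \<le> (real t + 1) * e / 2"
  shows "pr n p A * pr n p B \<le> (1 - \<delta>) * (p ^ t)\<^sup>2 \<or>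
    2 * pr n p (\<lambda>w. A w \<and> ht w t < int t) \<le> pr n p (\<lambda>w. int t \<le> ht w t \<and> \<not> B w) \<and>
    2 * pr n p (\<lambda>w. B w \<and> ht w t < int t) \<le> pr n p (\<lambda>w. int t \<le> ht w t \<and> \<not> A w)"
    (is "?small \<or> ?stable")
proof -
  let ?a = "pr n p A" and ?b = "pr n p B" and ?P = "p ^ t"
  have nn: "0 \<le> pr n p Q" for Q using pr_nonneg p_facts by blast
  have p1: "p * (real t + 1) \<le> 1"
    using e(2) mult_nonneg_nonneg[of "real t + 1" e] e(1) by linarith
  have aP: "\<alpha> ^ t \<le> (272 / 100) * ?P" using alpha_power_le(2)[OF p1] t by simp
  have P0: "0 < ?P" using p0 by simp
  have small: ?small if "?a * ?b \<le> 99 / 100 * ?P\<^sup>2"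
  proof -
    have "99 / 100 * ?P\<^sup>2 \<le> (1 - \<delta>) * ?P\<^sup>2" using \<delta>(1) by (intro mult_right_mono) auto
    then show ?thesis using that by linarith
  qed
  have A_le: "?a \<le> \<alpha> ^ u"
    using pr_mono[OF p_facts(1,2), of n A "hits u"] hitA pr_hits_le[of n u] by force
  have B_le: "?b \<le> \<alpha> ^ v"
    using pr_mono[OF p_facts(1,2), of n B "hits v"] hitB pr_hits_le[of n v] by force
  have aP2: "(\<alpha> ^ t)\<^sup>2 \<le> ((272 / 100) * ?P)\<^sup>2" using aP p_facts by (intro power_mono) auto
  show ?thesis
  proof (cases "u + v = 2 * t")
    case False
    have "?a * ?b \<le> \<alpha> ^ u * \<alpha> ^ v" using A_le B_le nn p_facts by (intro mult_mono) auto
    also have "\<dots> = \<alpha> ^ (u + v)" by (simp add: power_add)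
    also have "\<dots> \<le> \<alpha> ^ (2 * t + 1)" using False uv(1) p_facts by (intro power_decreasing) auto
    also have "\<dots> = \<alpha> * (\<alpha> ^ t)\<^sup>2" by (simp add: power_mult[symmetric] mult.commute)
    also have "\<dots> \<le> 1 / 14 * ((272 / 100) * ?P)\<^sup>2" using aP2 p_facts by (intro mult_mono) auto
    also have "\<dots> \<le> 99 / 100 * ?P\<^sup>2" by (simp add: power_mult_distrib) (simp add: power2_eq_square)
    finally show ?thesis using small by blast
  next
    case uveq: True
    have aa: "\<alpha> ^ u * \<alpha> ^ v = (\<alpha> ^ t)\<^sup>2" using uveq by (metis power_add power_mult mult.commute)
    \<comment> \<open>The loss factor \<open>2 * p \<le> 2 / 15\<close> outweighs the square of
      272/100: their product is about 0.986.\<close>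
    have twice: ?small if "?a * ?b \<le> 2 * p * \<alpha> ^ u * \<alpha> ^ v"
    proof -
      have "2 * p * \<alpha> ^ u * \<alpha> ^ v = 2 * p * (\<alpha> ^ t)\<^sup>2" using aa by simp
      also have "\<dots> \<le> 2 / 15 * ((272 / 100) * ?P)\<^sup>2" using aP2 p15 by (intro mult_mono) auto
      also have "\<dots> \<le> 99 / 100 * ?P\<^sup>2" by (simp add: power_mult_distrib) (simp add: power2_eq_square)
      finally show ?thesis using small that by linarith
    qed
    show ?thesis
    proof (cases "(\<exists>a. length a = n \<and> A a \<and> \<not> hits_twice u a) \<and> (\<exists>b. length b = n \<and> B b \<and> \<not> hits_twice v b)")
      case False
      then consider "\<And>a. length a = n \<Longrightarrow> A a \<Longrightarrow> hits_twice u a" | "\<And>b. length b = n \<Longrightarrow> B b \<Longrightarrow> hits_twice v b"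
        by blast
      then show ?thesis
      proof cases
        case 1
        then have "?a \<le> 2 * p * \<alpha> ^ u"
          using pr_mono[OF p_facts(1,2), of n A "hits_twice u"] pr_hits_twice_le[of n u] by force
        then have "?a * ?b \<le> (2 * p * \<alpha> ^ u) * \<alpha> ^ v" using B_le nn p_facts by (intro mult_mono) auto
        then show ?thesis using twice by blast
      next
        case 2
        then have "?b \<le> 2 * p * \<alpha> ^ v"
          using pr_mono[OF p_facts(1,2), of n B "hits_twice v"] pr_hits_twice_le[of n v] by force
        then have "?a * ?b \<le> \<alpha> ^ u * (2 * p * \<alpha> ^ v)" using A_le nn p_facts by (intro mult_mono) auto
        then show ?thesis using twice by (simp add: mult_ac)
      qed
    next
      case True
      then obtain a0 b0 where a0: "length a0 = n" "A a0" "\<not> hits_twice u a0"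
        and b0: "length b0 = n" "B b0" "\<not> hits_twice v b0" by blast
      \<comment> \<open>Walks that hit their levels only once never exceed them, so a height sum of
        \<open>2 * t = u + v\<close> forces equality in both.\<close>
      have meet: "\<exists>k\<le>n. ht a k = int u \<and> ht b k = int v"
        if ab: "length a = n" "A a" "\<not> hits_twice u a" "length b = n" "B b" "\<not> hits_twice v b" for a b
      proof -
        obtain k where k: "k \<le> n" "2 * int t \<le> ht a k + ht b k" using cross[OF ab(1,4,2,5)] by blast
        moreover have "ht a k \<le> int u" "ht b k \<le> int v"
          using ab k(1) by (auto intro: not_hits_twice_le)
        ultimately show ?thesis using uveq by (intro exI[of _ k]) auto
      qed
      have unique: "k = l" if "\<not> hits_twice x w" "length w = n" "k \<le> n" "l \<le> n" "ht w k = int x" "ht w l = int x"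
        for x w k l
        using that unfolding hits_twice_def by (metis linorder_neqE_nat order_refl)
      obtain T where T: "T \<le> n" "ht a0 T = int u" "ht b0 T = int v" using meet a0 b0 by blast
      \<comment> \<open>The walk \<open>b0\<close> is at height \<open>v\<close> only at time
        \<open>T\<close>, so every single-hit walk of \<open>A\<close> must meet it there.\<close>
      have singleA: "ht a T = int u" if "length a = n" "A a" "\<not> hits_twice u a" for a
        using meet[OF that b0] unique[OF b0(3,1)] T by metis
      have singleB: "ht b T = int v" if "length b = n" "B b" "\<not> hits_twice v b" for b
        using meet[OF a0 that] unique[OF a0(3,1)] T by metis
      have firstA: "first_hits_at u T a" if "length a = n" "A a" "\<not> hits_twice u a" for a
        using singleA[OF that] that T(1) unfolding first_hits_at_def hits_twice_def
        by (metis linorder_not_less order_refl)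
      have firstB: "first_hits_at v T b" if "length b = n" "B b" "\<not> hits_twice v b" for b
        using singleB[OF that] that T(1) unfolding first_hits_at_def hits_twice_def
        by (metis linorder_not_less order_refl)
      have uT: "u \<le> T" "v \<le> T" using ht_le_self[of a0 T] ht_le_self[of b0 T] T by auto
      have par: "even (T + u)" "even (T + v)"
        using ht_parity[of T a0] ht_parity[of T b0] a0(1) b0(1) T by (simp_all add: add.commute flip: of_nat_add)
      show ?thesis
      proof (cases "u + 4 \<le> T")
        case True
        have "T = u + 2 * ((T - u) div 2)" "T = v + 2 * ((T - v) div 2)" "2 \<le> (T - u) div 2"
          using par uT True by presburger+
        moreover have "?a \<le> 2 * p * \<alpha> ^ u + (1 - 2 * p) * first_passage p u T"
          using firstA by (intro order_trans[OF pr_mono pr_hits_twice_or_first_le] p_facts(1,2)) blast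
        moreover have "?b \<le> 2 * p * \<alpha> ^ v + (1 - 2 * p) * first_passage p v T"
          using firstB by (intro order_trans[OF pr_mono pr_hits_twice_or_first_le] p_facts(1,2)) blast
        ultimately show ?thesis
          using small late_passage_product_le[OF t p1 uveq uv(2)] nn by blast
      next
        case False
        then have Tu: "T \<le> u + 2" using par(1) uT(1) by presburger
        let ?excA = "pr n p (\<lambda>w. A w \<and> ht w T < int u)" and ?defA = "pr n p (\<lambda>w. int u \<le> ht w T \<and> \<not> A w)"
          and ?FA = "pr n p (\<lambda>w. int u \<le> ht w T)"
        let ?excB = "pr n p (\<lambda>w. B w \<and> ht w T < int v)" and ?defB = "pr n p (\<lambda>w. int v \<le> ht w T \<and> \<not> B w)"
          and ?FB = "pr n p (\<lambda>w. int v \<le> ht w T)"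
        have exA: "?excA * ((1 - 2 * p) * first_passage p v T) \<le> 2 * p * \<alpha> ^ u * ?defB"
          using singleA hitA cross uveq T(1) Tu par(1) by (intro pr_excess_le[of u v t]) auto
        have exB: "?excB * ((1 - 2 * p) * first_passage p u T) \<le> 2 * p * \<alpha> ^ v * ?defA"
        proof (rule pr_excess_le[of v u t])
          show "\<exists>k\<le>n. 2 * int t \<le> ht b k + ht a k"
            if "length b = n" "length a = n" "B b" "A a" for b a
            using cross[OF that(2,1,4,3)] by (simp add: add.commute)
        qed (use singleB hitB uveq T(1) Tu uv(2) par(2) in auto)
        have splitA: "?a = ?FA - ?defA + ?excA"
        proof -
          have "pr n p (\<lambda>w. int u \<le> ht w T \<and> A w) = pr n p (\<lambda>w. A w \<and> int u \<le> ht w T)"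
            by (simp only: conj_commute)
          then show ?thesis
            using pr_split[of n p A "\<lambda>w. int u \<le> ht w T"] pr_split[of n p "\<lambda>w. int u \<le> ht w T" A]
            unfolding not_le by linarith
        qed
        have splitB: "?b = ?FB - ?defB + ?excB"
        proof -
          have "pr n p (\<lambda>w. int v \<le> ht w T \<and> B w) = pr n p (\<lambda>w. B w \<and> int v \<le> ht w T)"
            by (simp only: conj_commute)
          then show ?thesis
            using pr_split[of n p B "\<lambda>w. int v \<le> ht w T"] pr_split[of n p "\<lambda>w. int v \<le> ht w T" B]
            unfolding not_le by linarith
        qed
        have q: "14 / 15 \<le> 1 - p" "13 / 15 \<le> 1 - 2 * p" using p15 by simp_all
        have t14: "14 \<le> real t" using t by simp
        \<comment> \<open>Here \<open>u \<le> v \<le> T \<le> u + 2\<close>, and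
          \<open>v - u\<close> and \<open>T - u\<close> are even.\<close>
        consider "u = t" "v = t" "T = t" | "u = t" "v = t" "T = t + 2"
          | m where "t = Suc m" "u = m" "v = m + 2" "T = m + 2"
        proof -
          have "T = u \<or> T = u + 2" using par(1) uT(1) Tu by presburger
          moreover have "v = u \<or> v = u + 1 \<or> v = u + 2" using uv(2) uT(2) Tu by linarith
          moreover have "v \<noteq> u + 1" using uveq by presburger
          ultimately consider "T = u" "v = u" | "T = u + 2" "v = u" | "T = u + 2" "v = u + 2"
            using uT(2) by fastforce
          then show ?thesis
          proof cases
            case 1
            then show ?thesis using that(1) uveq by simp
          next
            case 2
            then show ?thesis using that(2) uveq by simp
          next
            case 3
            then show ?thesis using that(3)[of u] uveq by simp
          qed
        qed
        then show ?thesis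
        proof cases
          case 1
          \<comment> \<open>The ratio \<open>2 * (1/15) * (272/100) / (13/15)\<close> is about 0.42,
            so an excess is at most half of the opposite deficit. This slack yields the stability
            alternative.\<close>
          have half: "2 * x \<le> y"
            if "x * ((1 - 2 * p) * first_passage p t t) \<le> 2 * p * \<alpha> ^ t * y" "0 \<le> x" "0 \<le> y" for x y
          proof -
            have "x * (13 / 15) * ?P \<le> x * (1 - 2 * p) * ?P"
              using q that P0 by (intro mult_right_mono mult_left_mono) auto
            also have "\<dots> \<le> 2 * p * \<alpha> ^ t * y" using that(1) by (simp only: first_passage_diag mult_ac)
            also have "\<dots> \<le> 2 * (1 / 15) * (272 / 100 * ?P) * y"
              using aP p15 p_facts that(3) by (intro mult_right_mono mult_mono) auto
            finally have "?P * (x * (13 / 15)) \<le> ?P * (2 * (1 / 15) * (272 / 100) * y)" by (simp only: mult_ac)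
            then have "x * (13 / 15) \<le> 2 * (1 / 15) * (272 / 100) * y" using P0 by (rule mult_left_le_imp_le)
            then show ?thesis using that(2,3) by linarith
          qed
          have "2 * ?excA \<le> ?defB" "2 * ?excB \<le> ?defA"
            using half[OF _ nn nn] exA exB unfolding 1 by blast+
          then show ?thesis unfolding 1 by blast
        next
          case 2
          \<comment> \<open>\<open>?P * ?\<phi>\<close> is the bound of
            \<open>pr_ht_second_le\<close> for at most one missing element of
            \<open>{1..t + 2}\<close>. It is below \<open>?P\<close> because
            \<open>?\<phi> = 1 - (1 - p) * (1 - p * (t + 1))\<close>.\<close>
          let ?\<phi> = "(real t + 2) * (p * (1 - p)) + p\<^sup>2"
          have fp: "first_passage p t (t + 2) = t * (?P * (p * (1 - p)))"
            using first_passage_ballot[of p t 1] by (simp add: ballot_1)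
          have le: "x \<le> y"
            if "x * ((1 - 2 * p) * first_passage p t (t + 2)) \<le> 2 * p * \<alpha> ^ t * y" "0 \<le> x" "0 \<le> y" for x y
          proof -
            have "(13 / 15) * (14 * (14 / 15)) \<le> (1 - 2 * p) * (t * (1 - p))"
              using q t14 by (intro mult_mono) auto
            then have "x * 6 * (p * ?P) \<le> x * ((1 - 2 * p) * (t * (1 - p))) * (p * ?P)"
              using q that p0 P0 by (intro mult_right_mono mult_left_mono) auto
            also have "\<dots> = x * ((1 - 2 * p) * first_passage p t (t + 2))" by (simp only: fp mult_ac)
            also have "\<dots> \<le> 2 * p * \<alpha> ^ t * y" by (rule that(1))
            also have "\<dots> \<le> 2 * p * (272 / 100 * ?P) * y"
              using aP p0 that(3) by (intro mult_right_mono mult_left_mono) auto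
            finally have "(p * ?P) * (x * 6) \<le> (p * ?P) * (2 * (272 / 100) * y)" by (simp only: mult_ac)
            then have "x * 6 \<le> 2 * (272 / 100) * y" 
              by (rule mult_left_le_imp_le) (use P0 p0 in simp)
            then show ?thesis using that(2,3) by linarith
          qed
          have \<phi>0: "0 < ?\<phi>" using p_facts p0 by (simp add: add_nonneg_pos)
          have "?excA \<le> ?defB" "?excB \<le> ?defA"
            using le[OF _ nn nn] exA exB unfolding 2 by blast+
          moreover define f where "f = ?P * ?\<phi>"
          have f: "0 < f" unfolding f_def using P0 \<phi>0 by (rule mult_pos_pos)
          ultimately have exc: "?excA * f \<le> ?defB * f" "?excB * f \<le> ?defA * f"
            by (auto intro!: mult_right_mono)
          have "?FA \<le> f" "?FB \<le> f"
            using pr_ht_second_le[of "t + 2" n] T(1) unfolding 2 f_def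
            by (simp_all add: algebra_simps power2_eq_square)
          then have "?a \<le> f - ?defA + ?excA" "?b \<le> f - ?defB + ?excB"
            using splitA splitB by linarith+
          then have "?a * ?b \<le> f * f" by (rule product_le_of_excess[OF f f nn nn _ _ exc])
          also have "\<dots> = ?\<phi>\<^sup>2 * ?P\<^sup>2" unfolding f_def by (simp only: power2_eq_square mult_ac)
          also have "\<dots> \<le> (1 - \<delta>) * ?P\<^sup>2"
          proof (rule mult_right_mono)
            have "1 / 2 * ((real t + 1) * e) \<le> (1 - p) * (1 - p * (real t + 1))"
              using e q t14 by (intro mult_mono) auto
            moreover have "?\<phi> = 1 - (1 - p) * (1 - p * (real t + 1))"
              by (simp add: algebra_simps power2_eq_square)
            ultimately have "?\<phi> \<le> 1 - \<delta>" "?\<phi> \<le> 1"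
              using \<delta>(2) mult_nonneg_nonneg[of "real t + 1" e] e(1) by linarith+
            moreover have "?\<phi>\<^sup>2 \<le> ?\<phi>" using \<phi>0 \<open>?\<phi> \<le> 1\<close> by (simp add: power2_eq_square mult_left_le_one_le)
            ultimately show "?\<phi>\<^sup>2 \<le> 1 - \<delta>" by linarith
          qed simp
          finally show ?thesis ..
        next
          case 3
          \<comment> \<open>The comparison families are unequal: at most one element of
            \<open>{1..t + 1}\<close> missing for \<open>A\<close>, none missing for
            \<open>B\<close>. The product of their bounds is \<open>p * ?\<psi>\<close> times the
            square of \<open>?P\<close>, and \<open>p * ?\<psi> \<le> p * (t + 1)\<close>.\<close>
          let ?\<psi> = "(real t + 1) * (1 - p) + p"
          let ?GA = "?P * ?\<psi>" and ?GB = "?P * p"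
          have P: "?P = p * p ^ m" using 3 by simp
          have \<psi>: "14 \<le> ?\<psi>" "?\<psi> \<le> real t + 1"
          proof -
            have "15 * (14 / 15) \<le> (real t + 1) * (1 - p)" using q t14 by (intro mult_mono) auto
            then show "14 \<le> ?\<psi>" using p0 by linarith
            show "?\<psi> \<le> real t + 1" using p0 by (simp add: algebra_simps)
          qed
          have FA: "?FA \<le> ?GA"
            using pr_ht_second_le[of "t + 1" n] T(1) 3 by (simp add: algebra_simps)
          have FB: "?FB \<le> ?GB"
            using pr_ht_top_le[of "m + 2" n] T(1) 3 by (simp add: algebra_simps)
          \<comment> \<open>The exchange constant is \<open>(544/100) / (13/15)\<close>, which is
            below 7 and so absorbed by \<open>?\<psi> \<ge> 14\<close>.\<close>
          have A1: "?excA * ?GB \<le> ?defB * ?GA"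
          proof -
            have am: "\<alpha> ^ m \<le> 272 / 100 * p ^ m"
            proof -
              have "\<alpha> ^ t * (1 - p) = \<alpha> ^ m * ((1 - p) * \<alpha>)" unfolding 3(1) by (simp only: power_Suc mult_ac)
              then have "\<alpha> ^ m * p = \<alpha> ^ t * (1 - p)" by (simp only: p_facts(6))
              also have "\<dots> \<le> (272 / 100 * ?P) * 1" using aP p0 p_facts by (intro mult_mono) auto
              finally have "p * \<alpha> ^ m \<le> p * (272 / 100 * p ^ m)" unfolding P by (simp only: mult_ac mult_1_right)
              then show ?thesis using p0 by (rule mult_left_le_imp_le)
            qed
            have "?excA * (13 / 15) * (p * ?P) \<le> ?excA * (1 - 2 * p) * (p * ?P)"
              using q nn p0 P0 by (intro mult_right_mono mult_left_mono) auto
            also have "\<dots> \<le> 2 * p * \<alpha> ^ m * ?defB"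
              using exA unfolding 3 first_passage_diag by (simp add: mult_ac)
            also have "\<dots> \<le> 2 * p * (272 / 100 * p ^ m) * ?defB"
              using am p0 nn by (intro mult_right_mono mult_left_mono) auto
            also have "\<dots> = 544 / 100 * (?P * ?defB)" using P by simp
            finally have "13 / 15 * (?excA * ?GB) \<le> 544 / 100 * (?P * ?defB)" by (simp only: mult_ac)
            then have "?excA * ?GB \<le> 7 * (?P * ?defB)"
              using mult_nonneg_nonneg[OF less_imp_le[OF P0] nn, of "\<lambda>w. int v \<le> ht w T \<and> \<not> B w"] by linarith
            also have "\<dots> \<le> ?\<psi> * (?P * ?defB)" using \<psi> P0 nn by (intro mult_right_mono) auto
            finally show ?thesis by (simp only: mult_ac)
          qed
          \<comment> \<open>Level \<open>v = m + 2\<close> contributes an additional factor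
            \<open>p\<close>, so the excess of \<open>B\<close> is at most \<open>p * p\<close>
            times the deficit of \<open>A\<close>; one of these factors absorbs
            \<open>?\<psi>\<close>.\<close>
          have B1: "?excB * ?GA \<le> ?defA * ?GB"
          proof -
            have fp: "first_passage p m (m + 2) = m * (?P * (1 - p))"
              using first_passage_ballot[of p m 1] P by (simp add: ballot_1)
            have "13 / 15 * (13 * (14 / 15 * (14 / 15))) \<le> (1 - 2 * p) * (m * ((1 - p) * (1 - p)))"
              using q t 3 by (intro mult_mono) auto
            then have "?excB * 8 * ?P \<le> ?excB * ((1 - 2 * p) * (m * ((1 - p) * (1 - p)))) * ?P"
              using q nn p0 P0 by (intro mult_right_mono mult_left_mono) auto
            also have "\<dots> = ?excB * ((1 - 2 * p) * first_passage p m (m + 2)) * (1 - p)"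
              by (simp only: fp mult_ac)
            also have "\<dots> \<le> 2 * p * \<alpha> ^ (m + 2) * ?defA * (1 - p)"
              using exB 3 p_facts by (intro mult_right_mono) auto
            also have "\<dots> = 2 * p * (\<alpha> ^ t * ((1 - p) * \<alpha>)) * ?defA" using 3 by simp
            also have "\<dots> = 2 * p * (\<alpha> ^ t * p) * ?defA" by (simp only: p_facts(6))
            also have "\<dots> \<le> 2 * p * ((272 / 100 * ?P) * p) * ?defA"
              using aP p0 nn by (intro mult_right_mono mult_left_mono) auto
            finally have "?P * (?excB * 8) \<le> ?P * (544 / 100 * (p * p * ?defA))" by (simp only: mult_ac)
            then have "?excB * 8 \<le> 544 / 100 * (p * p * ?defA)" using P0 by (rule mult_left_le_imp_le)
            moreover have "0 \<le> p * p * ?defA" using p0 nn by simp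
            ultimately have "?excB \<le> p * p * ?defA" by linarith
            then have "?excB * ?\<psi> \<le> p * p * ?defA * ?\<psi>" using \<psi> by (intro mult_right_mono) auto
            also have "\<dots> = p * ?defA * (p * ?\<psi>)" by (simp only: mult_ac)
            also have "\<dots> \<le> p * ?defA * 1"
            proof -
              have "p * ?\<psi> \<le> p * (real t + 1)" using \<psi>(2) p0 by (intro mult_left_mono) auto
              from order_trans[OF this p1] show ?thesis using p0 nn by (intro mult_left_mono) auto
            qed
            finally have "?P * (?excB * ?\<psi>) \<le> ?P * (p * ?defA * 1)" using P0 by (intro mult_left_mono) auto
            then show ?thesis by (simp only: mult_ac mult_1_right)
          qed
          have G: "0 < ?GA" "0 < ?GB" using \<psi> P0 p0 by auto
          have "?a \<le> ?GA - ?defA + ?excA" "?b \<le> ?GB - ?defB + ?excB"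
            unfolding splitA splitB using FA FB by simp_all
          then have "?a * ?b \<le> ?GA * ?GB" by (rule product_le_of_excess[OF G nn nn _ _ A1 B1])
          also have "\<dots> = (p * ?\<psi>) * ?P\<^sup>2" by (simp add: power2_eq_square)
          also have "\<dots> \<le> (1 - \<delta>) * ?P\<^sup>2"
          proof (rule mult_right_mono)
            have "p * ?\<psi> \<le> p * (real t + 1)" using \<psi>(2) p0 by (intro mult_left_mono) auto
            then show "p * ?\<psi> \<le> 1 - \<delta>"
              using e \<delta>(2) mult_nonneg_nonneg[of "real t + 1" e] by linarith
          qed simp
          finally show ?thesis ..
        qed
      qed
    qed
  qed
qed

end

section \<open>Shifted families as sets of walks\<close>

definition set_of_walk :: "bool list \<Rightarrow> nat set" where
  "set_of_walk w = {i. 1 \<le> i \<and> i \<le> length w \<and> w ! (i - 1)}"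

lemma set_of_walk_Cons:
  "set_of_walk (x # w) = (if x then insert 1 (Suc ` set_of_walk w) else Suc ` set_of_walk w)"
proof -
  have "i \<in> set_of_walk (x # w) \<longleftrightarrow> x \<and> i = 1 \<or> i \<in> Suc ` set_of_walk w" for i
  proof (cases i)
    case (Suc j)
    then show ?thesis by (cases j) (auto simp: set_of_walk_def)
  qed (auto simp: set_of_walk_def)
  then show ?thesis by auto
qed

lemma ht_eq_card:
  "k \<le> length w \<Longrightarrow> ht w k = 2 * int (card (set_of_walk w \<inter> {1..k})) - int k"
proof (induction w arbitrary: k)
  case Nil
  then show ?case by simp
next
  case (Cons x w)
  show ?case
  proof (cases k)
    case 0
    then show ?thesis by simp
  next
    case (Suc j)
    let ?S = "Suc ` (set_of_walk w \<inter> {1..j})"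
    have "Suc ` set_of_walk w \<inter> {1..Suc j} = ?S" by (auto simp: set_of_walk_def)
    then have "set_of_walk (x # w) \<inter> {1..k} = (if x then insert 1 ?S else ?S)"
      unfolding set_of_walk_Cons Suc by auto
    moreover have "card ?S = card (set_of_walk w \<inter> {1..j})" by (intro card_image) simp
    moreover have "1 \<notin> ?S" "finite ?S" by auto
    ultimately have "card (set_of_walk (x # w) \<inter> {1..k}) =
        (if x then 1 else 0) + card (set_of_walk w \<inter> {1..j})" by simp
    then show ?thesis using Cons Suc by simp
  qed
qed

lemma set_of_walk_surj:
  assumes "F \<subseteq> {1..n}"
  obtains w where "length w = n" "set_of_walk w = F"
proof (rule that)
  let ?w = "map (\<lambda>i. Suc i \<in> F) [0..<n]"
  show "length ?w = n" by simp
  have "i \<in> set_of_walk ?w \<longleftrightarrow> i \<in> F" for i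
    using assms by (cases i) (auto simp: set_of_walk_def)
  then show "set_of_walk ?w = F" by blast
qed

text \<open>The first step decides whether 1 belongs to the set, and the remaining walk describes
  the other elements moved down by one. Hence \<open>Pow {1..Suc n}\<close> is split by membership
  of 1.\<close>

lemma pr_eq_sum:
  "pr n p (\<lambda>w. Q (set_of_walk w)) = (\<Sum>F\<in>Pow {1..n}. of_bool (Q F) * mu_set n p F)"
proof (induction n arbitrary: Q)
  case 0
  have "set_of_walk [] = {}" by (auto simp: set_of_walk_def)
  moreover have "(\<Sum>F\<in>{{}}. of_bool (Q F) * mu_set 0 p F) = of_bool (Q {})"
    by (subst sum.insert) (auto simp: mu_set_def)
  ultimately show ?case by (simp del: sum.insert sum_of_bool_mult_eq)
next
  case (Suc n)
  let ?S = "image Suc ` Pow {1..n}"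
  have "{1..Suc n} = insert 1 (Suc ` {1..n})"
    by (metis atLeastAtMost_insertL image_Suc_atLeastAtMost le_add1 One_nat_def plus_1_eq_Suc)
  then have Pow: "Pow {1..Suc n} = ?S \<union> insert 1 ` ?S"
    by (simp only: Pow_insert image_Pow_surj[OF refl])
  have inj1: "inj_on (image Suc) (Pow {1..n})" 
    by (rule inj_onI) (metis inj_image_eq_iff inj_Suc)
  have no1: "1 \<notin> F" if "F \<in> ?S" for F using that by auto
  then have inj2: "inj_on (insert 1) ?S" by (intro inj_onI) (metis insert_ident)
  have "1 \<in> F" if "F \<in> insert 1 ` ?S" for F using that by blast
  then have disj: "?S \<inter> insert 1 ` ?S = {}" using no1 by blast
  have card: "card (Suc ` F) = card F" for F by (simp add: card_image)
  have le: "card F \<le> n" "finite F" "0 \<notin> F" if "F \<in> Pow {1..n}" for F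
    using that card_mono[of "{1..n}" F] finite_subset[of F] by auto
  have mu_up: "mu_set (Suc n) p (insert 1 (Suc ` F)) = p * mu_set n p F"
    and mu_right: "mu_set (Suc n) p (Suc ` F) = (1 - p) * mu_set n p F" if "F \<in> Pow {1..n}" for F
    using le[OF that] card[of F] by (auto simp: mu_set_def Suc_diff_le card_insert_if)
  have "(\<Sum>F\<in>Pow {1..Suc n}. of_bool (Q F) * mu_set (Suc n) p F) =
      (\<Sum>F\<in>?S. of_bool (Q F) * mu_set (Suc n) p F) + (\<Sum>F\<in>insert 1 ` ?S. of_bool (Q F) * mu_set (Suc n) p F)"
    unfolding Pow by (rule sum.union_disjoint) (use disj in auto)
  also have "\<dots> = (\<Sum>F\<in>Pow {1..n}. of_bool (Q (Suc ` F)) * mu_set (Suc n) p (Suc ` F)) +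
      (\<Sum>F\<in>Pow {1..n}. of_bool (Q (insert 1 (Suc ` F))) * mu_set (Suc n) p (insert 1 (Suc ` F)))"
    by (simp only: sum.reindex[OF inj2] sum.reindex[OF inj1] o_def)
  also have "\<dots> = (1 - p) * (\<Sum>F\<in>Pow {1..n}. of_bool (Q (Suc ` F)) * mu_set n p F) +
      p * (\<Sum>F\<in>Pow {1..n}. of_bool (Q (insert 1 (Suc ` F))) * mu_set n p F)"
    unfolding sum_distrib_left by (intro arg_cong2[of _ _ _ _ "(+)"] sum.cong refl) (simp_all only: mu_up mu_right mult_ac)
  also have "\<dots> = pr (Suc n) p (\<lambda>w. Q (set_of_walk w))"
    using Suc[of "\<lambda>F. Q (Suc ` F)"] Suc[of "\<lambda>F. Q (insert 1 (Suc ` F))"]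
    by (simp add: set_of_walk_Cons)
  finally show ?case ..
qed

lemma mu_eq_pr:
  assumes "\<A> \<subseteq> Pow {1..n}"
  shows "mu n p \<A> = pr n p (\<lambda>w. set_of_walk w \<in> \<A>)"
proof -
  have "(\<Sum>F\<in>Pow {1..n}. of_bool (F \<in> \<A>) * mu_set n p F) = (\<Sum>F\<in>\<A>. of_bool (F \<in> \<A>) * mu_set n p F)"
    by (rule sum.mono_neutral_right) (use assms in auto)
  also have "\<dots> = (\<Sum>F\<in>\<A>. mu_set n p F)" by (intro sum.cong) auto
  finally show ?thesis using pr_eq_sum[of n p "\<lambda>F. F \<in> \<A>"] by (simp only: mu_def)
qed

section \<open>From cross intersection of families to meeting of walks\<close>

lemma shifted_cross_intersecting_meet:
  assumes sh: "shifted n \<A>" and sub: "\<A> \<subseteq> Pow {1..n}" "\<B> \<subseteq> Pow {1..n}"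
    and cross: "cross_intersecting t \<A> \<B>" and t: "0 < t"
    and "F \<in> \<A>" and G: "G \<in> \<B>"
  shows "\<exists>k\<le>n. k + t \<le> card (F \<inter> {1..k}) + card (G \<inter> {1..k})"
  using \<open>F \<in> \<A>\<close>
  \<comment> \<open>In a counterexample, shifting the \<open>t\<close>-th common element to a free place below it gives a
    counterexample with a smaller intersection.\<close>
proof (induction "card (F \<inter> G)" arbitrary: F rule: less_induct)
  case less
  show ?case
  proof (rule ccontr)
    assume contra: "\<not> ?thesis"
    have FG: "F \<subseteq> {1..n}" "G \<subseteq> {1..n}" using less.prems G sub by auto
    then have fin: "finite F" "finite G" by (auto intro: finite_subset)
    let ?c = "\<lambda>i. card (F \<inter> G \<inter> {1..i})"
    define i where "i = (LEAST i. t \<le> ?c i)"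
    have "F \<inter> G \<inter> {1..n} = F \<inter> G" using FG by auto
    then have tn: "t \<le> ?c n" using cross less.prems G by (auto simp: cross_intersecting_def)
    then have ti: "t \<le> ?c i" unfolding i_def by (rule LeastI)
    have i_n: "i \<le> n" unfolding i_def using tn by (rule Least_le)
    have less_t: "?c k < t" if "k < i" for k
      using not_less_Least[of k "\<lambda>i. t \<le> ?c i"] that unfolding i_def by simp
    have i0: "i \<noteq> 0" using ti t by (intro notI) simp
    have i_in: "i \<in> F \<inter> G"
    proof (rule ccontr)
      assume "i \<notin> F \<inter> G"
      then have "F \<inter> G \<inter> {1..i} = F \<inter> G \<inter> {1..i - 1}"
        by (auto simp: le_less)
      then show False using less_t[of "i - 1"] ti i0 by simp
    qed
    have card_union: "card (H \<inter> {1..k}) + card (G \<inter> {1..k}) = card ((H \<union> G) \<inter> {1..k}) + card (H \<inter> G \<inter> {1..k})"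
      for H k
      using card_Un_Int[of "H \<inter> {1..k}" "G \<inter> {1..k}"] by (simp add: Int_Un_distrib2 Int_ac)
    have "card (F \<inter> {1..i}) + card (G \<inter> {1..i}) < i + t" using contra i_n by (meson not_le)
    \<comment> \<open>The counts of \<open>F\<close> and \<open>G\<close> add up to union plus
      intersection. With at least \<open>t\<close> common elements in \<open>{1..i}\<close>, the
      union must miss a point \<open>x\<close> of it.\<close>
    then have "card ((F \<union> G) \<inter> {1..i}) < card {1..i}" using ti card_union[of F i] by simp
    then have "(F \<union> G) \<inter> {1..i} \<noteq> {1..i}" by (metis less_irrefl)
    then obtain x where "x \<in> {1..i}" "x \<notin> F \<union> G" by blast
    then have x: "1 \<le> x" "x \<le> i" "x \<notin> F" "x \<notin> G" by auto
    have xi: "x < i" using x i_in by (metis IntD1 le_neq_implies_less)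
    let ?F = "F - {i} \<union> {x}"
    have "F \<inter> {x, i} = {i}" using x i_in by auto
    then have F': "?F \<in> \<A>"
      using sh less.prems x(1) xi i_n unfolding shifted_def by blast
    have "?F \<inter> G \<subset> F \<inter> G" using x i_in by auto
    then have "card (?F \<inter> G) < card (F \<inter> G)" using fin by (intro psubset_card_mono) auto
    then obtain k where k: "k \<le> n" "k + t \<le> card (?F \<inter> {1..k}) + card (G \<inter> {1..k})"
      using less.hyps F' by blast
    \<comment> \<open>For \<open>k < i\<close> the new set shares fewer than \<open>t\<close>
      elements with \<open>G\<close> inside \<open>{1..k}\<close>, since \<open>x\<close> is not in
      \<open>G\<close>; for \<open>k \<ge> i\<close> the exchange leaves the count of
      \<open>F\<close> unchanged.\<close>
    show False
    proof (cases "k < i")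
      case True
      have "card ((?F \<union> G) \<inter> {1..k}) \<le> card {1..k}" by (intro card_mono) auto
      moreover have "card (?F \<inter> G \<inter> {1..k}) \<le> ?c k" using x fin by (intro card_mono) auto
      ultimately show False using k(2) card_union[of ?F k] less_t[OF True] by simp
    next
      case False
      then have "?F \<inter> {1..k} = insert x (F \<inter> {1..k} - {i})" "i \<in> F \<inter> {1..k}" "x \<notin> F \<inter> {1..k} - {i}"
        using x xi i_in i0 by auto
      then have "card (?F \<inter> {1..k}) = card (F \<inter> {1..k})"
        using card.remove[of "F \<inter> {1..k}" i] by simp
      then show False using contra k by simp
    qed
  qed
qed

lemma walks_meet:
  assumes "shifted n \<A>" "\<A> \<subseteq> Pow {1..n}" "\<B> \<subseteq> Pow {1..n}" "cross_intersecting t \<A> \<B>" "0 < t"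
    and "length a = n" "length b = n" "set_of_walk a \<in> \<A>" "set_of_walk b \<in> \<B>"
  shows "\<exists>k\<le>n. 2 * int t \<le> ht a k + ht b k"
proof -
  obtain k where k: "k \<le> n"
    "k + t \<le> card (set_of_walk a \<inter> {1..k}) + card (set_of_walk b \<inter> {1..k})"
    using shifted_cross_intersecting_meet[OF assms(1-5,8,9)] by blast
  then have "2 * int t \<le> ht a k + ht b k"
    using ht_eq_card[of k a] ht_eq_card[of k b] assms(6,7) by simp
  then show ?thesis using k(1) by blast
qed

lemma set_of_walk_in_F0:
  assumes "length w = n" "t \<le> n"
  shows "set_of_walk w \<in> F0 t n \<longleftrightarrow> int t \<le> ht w t"
proof -
  let ?S = "set_of_walk w \<inter> {1..t}"
  have "set_of_walk w \<in> F0 t n \<longleftrightarrow> ?S = {1..t}"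
  proof -
    have "set_of_walk w \<subseteq> {1..n}" using assms(1) by (auto simp: set_of_walk_def)
    then show ?thesis unfolding F0_def by blast
  qed
  also have "\<dots> \<longleftrightarrow> t \<le> card ?S"
  proof
    assume "t \<le> card ?S"
    moreover have "card ?S \<le> card {1..t}" by (intro card_mono) auto
    ultimately have "card ?S = card {1..t}" by simp
    then show "?S = {1..t}" by (intro card_subset_eq) simp_all
  qed simp
  also have "\<dots> \<longleftrightarrow> int t \<le> ht w t"
    using ht_eq_card[of t w] assms by auto
  finally show ?thesis .
qed

lemma mu_sym_diff_F0:
  assumes "\<A> \<subseteq> Pow {1..n}" "t \<le> n"
  shows "mu n p (sym_diff \<A> (F0 t n)) =
    pr n p (\<lambda>w. set_of_walk w \<in> \<A> \<and> ht w t < int t) + pr n p (\<lambda>w. int t \<le> ht w t \<and> set_of_walk w \<notin> \<A>)"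
proof -
  have "sym_diff \<A> (F0 t n) \<subseteq> Pow {1..n}" using assms(1) by (auto simp: F0_def)
  then have "mu n p (sym_diff \<A> (F0 t n)) = pr n p (\<lambda>w. set_of_walk w \<in> sym_diff \<A> (F0 t n))"
    by (rule mu_eq_pr)
  also have "\<dots> = pr n p (\<lambda>w. set_of_walk w \<in> sym_diff \<A> (F0 t n) \<and> set_of_walk w \<in> \<A>) +
      pr n p (\<lambda>w. set_of_walk w \<in> sym_diff \<A> (F0 t n) \<and> set_of_walk w \<notin> \<A>)"
    by (rule pr_split)
  also have "\<dots> = pr n p (\<lambda>w. set_of_walk w \<in> \<A> \<and> ht w t < int t) +
      pr n p (\<lambda>w. int t \<le> ht w t \<and> set_of_walk w \<notin> \<A>)"
    using set_of_walk_in_F0[OF _ assms(2)] by (intro arg_cong2[of _ _ _ _ "(+)"] pr_cong) auto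
  finally show ?thesis .
qed

lemma mu_le_excess:
  assumes p: "0 < p" "p \<le> 1 / 15" and "\<A> \<subseteq> Pow {1..n}" "t \<le> n"
  shows "mu n p \<A> \<le> p ^ t + pr n p (\<lambda>w. set_of_walk w \<in> \<A> \<and> ht w t < int t) -
    pr n p (\<lambda>w. int t \<le> ht w t \<and> set_of_walk w \<notin> \<A>)"
proof -
  let ?A = "\<lambda>w. set_of_walk w \<in> \<A>"
  have "pr n p (\<lambda>w. int t \<le> ht w t \<and> ?A w) = pr n p (\<lambda>w. ?A w \<and> int t \<le> ht w t)"
    by (simp only: conj_commute)
  then show ?thesis
    using pr_split[of n p ?A "\<lambda>w. int t \<le> ht w t"] pr_split[of n p "\<lambda>w. int t \<le> ht w t" ?A]
      pr_ht_top_le[OF p assms(4)]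
    unfolding not_le mu_eq_pr[OF assms(3)] by linarith
qed

section \<open>Choice of the constant and return to measures of families\<close>

theorem theorem1p4:
  fixes t :: nat and \<epsilon> :: real
  assumes "t \<ge> 14" and "\<epsilon> > 0"
  shows "\<exists>\<gamma>::real. 0 < \<gamma> \<and> \<gamma> \<le> 1 \<and>
    (\<forall>(n::nat) (\<eta>::real) (p::real) (\<A>::nat set set) (\<B>::nat set set).
       n \<ge> t \<and> 0 < \<eta> \<and> \<eta> \<le> 1 \<and> 0 < p \<and> p \<le> 1 / (real t + 1) - \<epsilon> \<and>
       \<A> \<subseteq> Pow {1..n} \<and> \<B> \<subseteq> Pow {1..n} \<and>
       shifted n \<A> \<and> shifted n \<B> \<and>
       inclusion_maximal n \<A> \<and> inclusion_maximal n \<B> \<and>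
       cross_intersecting t \<A> \<B> \<longrightarrow>
         sqrt (mu n p \<A> * mu n p \<B>) < (1 - \<gamma> * \<eta>) * p ^ t \<or>
         mu n p (sym_diff \<A> (F0 t n)) + mu n p (sym_diff \<B> (F0 t n)) < \<eta> * p ^ t)"
proof -
  \<comment> \<open>Chosen so that \<open>2 * \<gamma> < \<delta>\<close> for the small-product case
    and \<open>\<gamma> < 1 / 6\<close> for the stable case.\<close>
  define \<gamma> :: real where "\<gamma> = min (1 / 400) \<epsilon>"
  define \<delta> :: real where "\<delta> = min (1 / 100) ((real t + 1) * \<epsilon> / 2)"
  have \<gamma>: "0 < \<gamma>" "\<gamma> \<le> 1 / 400" using assms(2) by (auto simp: \<gamma>_def)
  have "15 * \<epsilon> \<le> (real t + 1) * \<epsilon>" using assms by (intro mult_right_mono) auto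
  moreover have "\<gamma> \<le> \<epsilon>" by (simp add: \<gamma>_def)
  ultimately have \<gamma>\<delta>: "2 * \<gamma> < \<delta>" using assms(2) \<gamma>(2) unfolding \<delta>_def min_less_iff_conj by linarith
  have "sqrt (mu n p \<A> * mu n p \<B>) < (1 - \<gamma> * \<eta>) * p ^ t \<or>
      mu n p (sym_diff \<A> (F0 t n)) + mu n p (sym_diff \<B> (F0 t n)) < \<eta> * p ^ t"
    (is "?small \<or> ?stable")
    if n: "n \<ge> t" and \<eta>: "0 < \<eta>" "\<eta> \<le> 1" and p: "0 < p" "p \<le> 1 / (real t + 1) - \<epsilon>"
      and sub: "\<A> \<subseteq> Pow {1..n}" "\<B> \<subseteq> Pow {1..n}" and sh: "shifted n \<A>"
      and cr: "cross_intersecting t \<A> \<B>"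
    for n and \<eta> p :: real and \<A> \<B>
  proof -
    let ?P = "p ^ t" and ?A = "\<lambda>w. set_of_walk w \<in> \<A>" and ?B = "\<lambda>w. set_of_walk w \<in> \<B>"
    have "p * (real t + 1) \<le> (1 / (real t + 1) - \<epsilon>) * (real t + 1)"
      using p(2) by (intro mult_right_mono) auto
    also have "\<dots> = 1 - (real t + 1) * \<epsilon>" by (simp add: field_simps)
    finally have pt: "p * (real t + 1) \<le> 1 - (real t + 1) * \<epsilon>" .
    have "1 / (real t + 1) \<le> 1 / 15" using assms(1) by (intro divide_left_mono) auto
    then have p15: "p \<le> 1 / 15" using p assms(2) by linarith
    have P0: "0 < ?P" using p(1) by simp
    have "\<gamma> * \<eta> \<le> \<gamma> * 1" using \<gamma> \<eta> by (intro mult_left_mono) auto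
    then have \<gamma>\<eta>: "\<gamma> * \<eta> \<le> \<gamma>" "0 \<le> \<gamma> * \<eta>" using \<gamma> \<eta> by auto
    then have factor: "0 < 1 - \<gamma> * \<eta>" using \<gamma>(2) by linarith
    have nn: "0 \<le> pr n p Q" for Q using pr_nonneg[of p n Q] p(1) p15 by simp
    have muA: "mu n p \<A> = pr n p ?A" and muB: "mu n p \<B> = pr n p ?B"
      using mu_eq_pr[OF sub(1)] mu_eq_pr[OF sub(2)] .
    show ?thesis
    proof (cases "\<A> = {} \<or> \<B> = {}")
      case True
      then have "sqrt (mu n p \<A> * mu n p \<B>) = 0" by (auto simp: mu_def)
      then show ?thesis using mult_pos_pos[OF factor P0] by linarith
    next
      case False
      then obtain F G where FG: "F \<in> \<A>" "G \<in> \<B>" by blast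
      obtain a where a: "length a = n" "?A a" using set_of_walk_surj[of F n] FG(1) sub(1) by blast
      obtain b where b: "length b = n" "?B b" using set_of_walk_surj[of G n] FG(2) sub(2) by blast
      have cross: "\<exists>k\<le>n. 2 * int t \<le> ht x k + ht y k"
        if "length x = n" "length y = n" "?A x" "?B y" for x y
        using walks_meet[OF sh sub cr _ that] assms(1) by simp
      obtain u where u: "\<And>w. length w = n \<Longrightarrow> ?A w \<Longrightarrow> hits u w"
        "\<exists>w. length w = n \<and> ?A w \<and> (\<forall>k\<le>n. ht w k \<le> int u)"
        using max_height_exists[of a n ?A] a by blast
      obtain v where v: "\<And>w. length w = n \<Longrightarrow> ?B w \<Longrightarrow> hits v w"
        "\<exists>w. length w = n \<and> ?B w \<and> (\<forall>k\<le>n. ht w k \<le> int v)"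
        using max_height_exists[of b n ?B] b by blast
      have uv: "2 * t \<le> u + v"
      proof -
        obtain x y where "length x = n" "?A x" "length y = n" "?B y"
          and le: "\<And>k. k \<le> n \<Longrightarrow> ht x k \<le> int u" "\<And>k. k \<le> n \<Longrightarrow> ht y k \<le> int v"
          using u(2) v(2) by blast
        then obtain k where "k \<le> n" "2 * int t \<le> ht x k + ht y k" using cross by blast
        then show ?thesis using le[of k] by linarith
      qed
      have \<delta>: "\<delta> \<le> 1 / 100" "\<delta> \<le> (real t + 1) * \<epsilon> / 2"
        unfolding \<delta>_def by (rule min.cobounded1, rule min.cobounded2)
      let ?excA = "pr n p (\<lambda>w. ?A w \<and> ht w t < int t)" and ?defA = "pr n p (\<lambda>w. int t \<le> ht w t \<and> \<not> ?A w)"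
      let ?excB = "pr n p (\<lambda>w. ?B w \<and> ht w t < int t)" and ?defB = "pr n p (\<lambda>w. int t \<le> ht w t \<and> \<not> ?B w)"
      consider "pr n p ?A * pr n p ?B \<le> (1 - \<delta>) * ?P\<^sup>2" | "2 * ?excA \<le> ?defB" "2 * ?excB \<le> ?defA"
      proof (cases "u \<le> v")
        case True
        have "pr n p ?A * pr n p ?B \<le> (1 - \<delta>) * ?P\<^sup>2 \<or> 2 * ?excA \<le> ?defB \<and> 2 * ?excB \<le> ?defA"
          by (rule walk_dichotomy[where A = ?A and B = ?B, OF p(1) p15 assms(1,2) pt cross u(1) v(1) uv True \<delta>])
        then show ?thesis using that by argo
      next
        case False
        \<comment> \<open>\<open>walk_dichotomy\<close> expects the lower level first, so the
          families exchange roles.\<close>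
        have cross': "\<exists>k\<le>n. 2 * int t \<le> ht y k + ht x k"
          if "length y = n" "length x = n" "?B y" "?A x" for x y
          using cross[OF that(2,1,4,3)] by (simp only: add.commute)
        have vu: "2 * t \<le> v + u" "v \<le> u" using uv False by auto
        have "pr n p ?B * pr n p ?A \<le> (1 - \<delta>) * ?P\<^sup>2 \<or> 2 * ?excB \<le> ?defA \<and> 2 * ?excA \<le> ?defB"
          by (rule walk_dichotomy[where A = ?B and B = ?A, OF p(1) p15 assms(1,2) pt cross' v(1) u(1) vu \<delta>])
        then show ?thesis using that unfolding mult.commute[of "pr n p ?B"] by argo
      qed
      then show ?thesis
      proof cases
        case 1
        have "(1 - \<gamma> * \<eta>)\<^sup>2 = 1 - 2 * (\<gamma> * \<eta>) + (\<gamma> * \<eta>)\<^sup>2" by (simp add: power2_eq_square algebra_simps)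
        then have "1 - \<delta> < (1 - \<gamma> * \<eta>)\<^sup>2" using \<gamma>\<eta> \<gamma>\<delta> zero_le_power2[of "\<gamma> * \<eta>"] by linarith
        then have "(1 - \<delta>) * ?P\<^sup>2 < (1 - \<gamma> * \<eta>)\<^sup>2 * ?P\<^sup>2"
          using zero_less_power[OF P0] by (rule mult_strict_right_mono)
        then have "mu n p \<A> * mu n p \<B> < ((1 - \<gamma> * \<eta>) * ?P)\<^sup>2"
          using 1 unfolding muA muB power_mult_distrib by linarith
        then show ?thesis using factor P0 by (intro disjI1 real_less_lsqrt) auto
      next
        case 2
        show ?thesis
        proof (rule disjCI)
          assume "\<not> ?stable"
          then have "\<eta> * ?P \<le> ?excA + ?defA + (?excB + ?defB)"
            unfolding mu_sym_diff_F0[OF sub(1) n] mu_sym_diff_F0[OF sub(2) n] by simp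
          \<comment> \<open>With total excess \<open>E\<close> and total deficit \<open>D\<close>,
            \<open>E \<le> D / 2\<close> gives \<open>D - E \<ge> (D + E) / 3\<close>, and
            \<open>D + E\<close> is the left side of the negated alternative.\<close>
          then have "(mu n p \<A> + mu n p \<B>) \<le> 2 * ?P - \<eta> * ?P / 3"
            using 2 mu_le_excess[OF p(1) p15 sub(1) n] mu_le_excess[OF p(1) p15 sub(2) n] by linarith
          then have mean: "(mu n p \<A> + mu n p \<B>) / 2 \<le> ?P - 1 / 6 * (\<eta> * ?P)" by simp
          have "sqrt (mu n p \<A> * mu n p \<B>) \<le> (mu n p \<A> + mu n p \<B>) / 2"
            unfolding muA muB by (rule arith_geo_mean_sqrt) (rule nn)+
          also note mean
          also have "?P - 1 / 6 * (\<eta> * ?P) < ?P - \<gamma> * (\<eta> * ?P)"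
            using \<gamma>(2) \<eta>(1) P0 by (intro diff_strict_left_mono mult_strict_right_mono) auto
          also have "\<dots> = (1 - \<gamma> * \<eta>) * ?P" by (simp add: algebra_simps)
          finally show ?small .
        qed
      qed
    qed
  qed
  then show ?thesis using \<gamma> by (intro exI[of _ \<gamma>]) auto
qed

end
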